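(* Let $k\ge 6$ be an integer and $\alpha\ge\beta\ge\frac{1+\sqrt2}{4}$. Then $$ \mathcal{M}_k^{\alpha,\beta}:=\max_{x\in[-1,1]}(1-x)^{\alpha+\frac12}(1+x)^{\beta+\frac12}\big({\bf P}_k^{(\alpha,\beta)}(x)\big)^2<3\,\alpha^{1/3}\left(1+\frac{\alpha}{k}\right)^{1/6}. $$
   Context: $P_k^{(\alpha,\beta)}$ denotes the Jacobi polynomial of degree $k$ in the standard (Szegő) normalization, orthogonal on $[-1,1]$ with respect to the weight $(1-x)^\alpha(1+x)^\beta$; its squared norm is ${\bf h}_k^2=\frac{2^{\alpha+\beta+1}\Gamma(k+\alpha+1)\Gamma(k+\beta+1)}{(2k+\alpha+\beta+1)\,k!\,\Gamma(k+\alpha+\beta+1)}$, and ${\bf P}_k^{(\alpha,\beta)}=P_k^{(\alpha,\beta)}/{\bf h}_k$ is the orthonormal Jacobi polynomial. *)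

theory Defs
  imports "HOL-Analysis.Analysis"
begin

text \<open>Jacobi polynomial in Szego normalization (Szego (4.3.2)):
  P_k^(a,b)(x) = sum_{s=0}^k binom(k+a, k-s) binom(k+b, s) ((x-1)/2)^s ((x+1)/2)^(k-s).\<close>
definition jacobiP :: "nat \<Rightarrow> real \<Rightarrow> real \<Rightarrow> real \<Rightarrow> real" where
  "jacobiP k a b x = (\<Sum>s\<le>k. ((real k + a) gchoose (k - s)) * ((real k + b) gchoose s)
       * ((x - 1) / 2) ^ s * ((x + 1) / 2) ^ (k - s))"

text \<open>Squared norm h_k^2.\<close>
definition jacobi_h2 :: "nat \<Rightarrow> real \<Rightarrow> real \<Rightarrow> real" where
  "jacobi_h2 k a b = 2 powr (a + b + 1) * Gamma (real k + a + 1) * Gamma (real k + b + 1)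
       / ((2 * real k + a + b + 1) * fact k * Gamma (real k + a + b + 1))"

definition jacobiPn :: "nat \<Rightarrow> real \<Rightarrow> real \<Rightarrow> real \<Rightarrow> real" where
  "jacobiPn k a b x = jacobiP k a b x / sqrt (jacobi_h2 k a b)"

definition jacobiM :: "nat \<Rightarrow> real \<Rightarrow> real \<Rightarrow> real" where
  "jacobiM k a b = (SUP x\<in>{-1..1}. (1 - x) powr (a + 1/2) * (1 + x) powr (b + 1/2)
       * (jacobiPn k a b x)^2)"

end

theory Submission
  imports Defs
begin

text \<open>
  With \<open>x = cos \<theta>\<close> and \<open>u = sqrt ((1 - x) powr (\<alpha> + 1/2) * (1 + x) powr (\<beta> + 1/2)) * P\<close> the Jacobi
  equation becomes \<open>u'' + Q u = 0\<close> with \<open>Q = N\<^sup>2 (\<delta> - x) (x - \<delta>') / (1 - x\<^sup>2)\<close> and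
  \<open>N = k + (\<alpha> + \<beta> + 1)/2\<close>, and the integral of \<open>u\<^sup>2 d\<theta>\<close> is the squared norm. So the
  task is to bound the maximum of \<open>u\<^sup>2\<close>, attained at \<open>x0\<close> say, by its integral. By reflection \<open>x0\<close> lies
  to the right of the midpoint of \<open>[\<delta>', \<delta>]\<close>. A virial identity with multiplier
  \<open>f = sin \<theta> ((\<delta> - x) powr (-1/2) - \<kappa>)\<close>, integrated over \<open>[-1, x0]\<close>, gives
  \<open>u(x0)\<^sup>2 sqrt (Q(x0)) \<le> C N * norm\<close> with \<open>C\<close> about \<open>4/3\<close>. On the other side of \<open>x0\<close>, growth of the
  energy \<open>u'\<^sup>2 + Q u\<^sup>2\<close> gives \<open>Q powr (3/2) \<ge> (2/3) dQ/d\<theta>\<close> at \<open>x0\<close>, which bounds \<open>Q(x0)\<close> from below by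
  a quantity of the right order in \<open>k\<close> and \<open>\<alpha>\<close>.
\<close>

subsection \<open>Derivatives and norms of Jacobi polynomials\<close>

text \<open>The virial estimate degenerates where \<open>Q\<close> vanishes, so a maximum close to
  the turning point is the obstacle. It is excluded by
  \<open>q ^ 3 > k / (100 * m^2 * (k + m))\<close>, where \<open>q = Q(x0) / N^2\<close> and m is
  the larger parameter. The virial estimate reads \<open>F x0 * sqrt q \<le> 1.388 * h2\<close>;
  eliminating q leaves the sixth power of \<open>F x0 / h2\<close> below
  \<open>1.388^6 * 100 * m^2 * (k + m) / k\<close>. Since 1.388^6 < 7.29 = 3^6 / 100, this accounts
  for the factor 3, the exponents 1/3 and 1/6, and the constant 100. Reflection exchanges the two
  parameters, so their order is lost once the maximum lies right of the midpoint; hence the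
  estimates in \<open>max a b\<close> and \<open>min a b\<close>. Differentiation takes place in x
  instead of \<theta>, on Jacobi weights times polynomials. Derivative identities become algebraic
  after multiplication by \<open>1 - x\<^sup>2\<close>, and the zeros of the polynomial cause no
  trouble.\<close>

lemma gbinomial_Suc_mult:
  fixes z :: "'a :: field_char_0"
  shows "(z gchoose Suc m) * of_nat (Suc m) = (z gchoose m) * (z - of_nat m)"
  using gbinomial_absorption[of m z] gbinomial_absorb_comp[of z m] by (simp add: mult.commute)

definition jacobi_coeff :: "nat \<Rightarrow> real \<Rightarrow> real \<Rightarrow> nat \<Rightarrow> real" where
  "jacobi_coeff k a b j = ((real k + a) gchoose (k - j)) * ((real k + b) gchoose j)"

lemma jacobiP_altdef:
  "jacobiP k a b x =
     (\<Sum>j\<le>k. jacobi_coeff k a b j * ((x - 1) / 2) ^ j * ((x + 1) / 2) ^ (k - j))"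
  by (simp add: jacobiP_def jacobi_coeff_def)

text \<open>Differentiation lowers either the power of (x - 1)/2 or that of (x + 1)/2. This relation
  serves the first kind of term and \<open>jacobi_coeff_Suc_same\<close> the second; both return in
  the raising identity.\<close>

lemma jacobi_coeff_Suc_lower:
  assumes "j \<le> n"
  shows "jacobi_coeff (Suc n) a b (Suc j) * real (Suc j) =
         jacobi_coeff n (a + 1) (b + 1) j * (real n - real j + b + 1)"
proof -
  have "((real n + b + 1) gchoose Suc j) * real (Suc j) =
        ((real n + b + 1) gchoose j) * (real n - real j + b + 1)"
    unfolding gbinomial_Suc_mult by (simp add: algebra_simps)
  moreover have "real (Suc n) + b = real n + b + 1" "real (Suc n) + a = real n + (a + 1)"
                "real n + (b + 1) = real n + b + 1"
    by simp_all
  ultimately show ?thesis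
    unfolding jacobi_coeff_def by (simp only: diff_Suc_Suc mult.assoc)
qed

lemma jacobi_coeff_Suc_same:
  assumes "j \<le> n"
  shows "jacobi_coeff (Suc n) a b j * real (Suc n - j) =
         jacobi_coeff n (a + 1) (b + 1) j * (real j + a + 1)"
proof -
  have "((real n + a + 1) gchoose Suc (n - j)) * real (Suc (n - j)) =
        ((real n + a + 1) gchoose (n - j)) * (real j + a + 1)"
    unfolding gbinomial_Suc_mult using assms by (simp add: algebra_simps of_nat_diff)
  hence "((real n + a + 1) gchoose Suc (n - j)) * y * real (Suc (n - j)) =
        ((real n + a + 1) gchoose (n - j)) * y * (real j + a + 1)" for y
    by (metis mult.assoc mult.commute)
  moreover have "real (Suc n) + a = real n + a + 1" "real (Suc n) + b = real n + (b + 1)"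
                "real n + (a + 1) = real n + a + 1" "Suc n - j = Suc (n - j)"
    using assms by auto
  ultimately show ?thesis
    unfolding jacobi_coeff_def by (simp only:)
qed

lemma jacobiP_deriv_sum:
  "(jacobiP n a b has_real_derivative
     (\<Sum>j\<le>n. jacobi_coeff n a b j *
        (real j * ((x - 1) / 2) ^ (j - 1) * ((x + 1) / 2) ^ (n - j) +
         real (n - j) * ((x - 1) / 2) ^ j * ((x + 1) / 2) ^ (n - j - 1))) / 2) (at x)"
proof -
  have "((\<lambda>x. c * ((x - 1) / 2) ^ j * ((x + 1) / 2) ^ m) has_real_derivative
          c * (real j * ((x - 1) / 2) ^ (j - 1) * ((x + 1) / 2) ^ m +
               real m * ((x - 1) / 2) ^ j * ((x + 1) / 2) ^ (m - 1)) / 2) (at x)" for c j m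
    by (auto intro!: derivative_eq_intros simp: algebra_simps add_divide_distrib)
  thus ?thesis
    unfolding jacobiP_altdef [abs_def] sum_divide_distrib by (intro DERIV_sum)
qed

lemma has_real_derivative_jacobiP:
  "(jacobiP (Suc n) a b has_real_derivative
     (real n + a + b + 2) / 2 * jacobiP n (a + 1) (b + 1) x) (at x)"
proof -
  define s t where "s = (x - 1) / 2" and "t = (x + 1) / 2"
  let ?c = "jacobi_coeff (Suc n) a b" and ?d = "jacobi_coeff n (a + 1) (b + 1)"
  have "(\<Sum>j\<le>Suc n. ?c j * (real j * s ^ (j - 1) * t ^ (Suc n - j) +
            real (Suc n - j) * s ^ j * t ^ (Suc n - j - 1))) =
        (\<Sum>j\<le>Suc n. ?c j * real j * s ^ (j - 1) * t ^ (Suc n - j)) +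
        (\<Sum>j\<le>Suc n. ?c j * real (Suc n - j) * s ^ j * t ^ (Suc n - j - 1))"
    by (simp add: sum.distrib [symmetric] algebra_simps del: sum.atMost_Suc)
  also have "(\<Sum>j\<le>Suc n. ?c j * real j * s ^ (j - 1) * t ^ (Suc n - j)) =
             (\<Sum>j\<le>n. ?c (Suc j) * real (Suc j) * s ^ j * t ^ (n - j))"
    by (subst sum.atMost_Suc_shift) simp
  also have "\<dots> = (\<Sum>j\<le>n. ?d j * (real n - real j + b + 1) * s ^ j * t ^ (n - j))"
    by (intro sum.cong refl) (simp only: jacobi_coeff_Suc_lower atMost_iff)
  also have "(\<Sum>j\<le>Suc n. ?c j * real (Suc n - j) * s ^ j * t ^ (Suc n - j - 1)) =
             (\<Sum>j\<le>n. ?c j * real (Suc n - j) * s ^ j * t ^ (n - j))"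
    by simp
  also have "\<dots> = (\<Sum>j\<le>n. ?d j * (real j + a + 1) * s ^ j * t ^ (n - j))"
    by (intro sum.cong refl) (simp only: jacobi_coeff_Suc_same atMost_iff)
  also have "(\<Sum>j\<le>n. ?d j * (real n - real j + b + 1) * s ^ j * t ^ (n - j)) + \<dots> =
             (real n + a + b + 2) * jacobiP n (a + 1) (b + 1) x"
    unfolding jacobiP_altdef s_def t_def
    by (simp add: sum.distrib [symmetric] sum_distrib_left algebra_simps)
  finally show ?thesis
    using jacobiP_deriv_sum[of "Suc n" a b x] by (simp add: s_def t_def del: sum.atMost_Suc)
qed

text \<open>With \<open>s = (x - 1)/2\<close> and \<open>t = (x + 1)/2\<close> both sides are homogeneous of degree
  \<open>Suc n\<close> in \<open>s, t\<close>, and the identity holds coefficientwise.\<close>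

lemma jacobiP_raising:
  obtains p' where "(jacobiP n (a + 1) (b + 1) has_real_derivative p') (at x)"
    and "(1 - x\<^sup>2) * p' = ((a + 1) * (1 + x) - (b + 1) * (1 - x)) * jacobiP n (a + 1) (b + 1) x
           - 2 * real (Suc n) * jacobiP (Suc n) a b x"
proof -
  define s t where "s = (x - 1) / 2" and "t = (x + 1) / 2"
  let ?c = "jacobi_coeff (Suc n) a b" and ?d = "jacobi_coeff n (a + 1) (b + 1)"
  define p' where "p' = (\<Sum>j\<le>n. ?d j * (real j * s ^ (j - 1) * t ^ (n - j) +
           real (n - j) * s ^ j * t ^ (n - j - 1))) / 2"
  let ?p = "jacobiP n (a + 1) (b + 1) x"
  have p: "?p = (\<Sum>j\<le>n. ?d j * s ^ j * t ^ (n - j))"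
    by (simp add: jacobiP_altdef s_def t_def)
  have summand: "s * t * (?d j * (real j * s ^ (j - 1) * t ^ (n - j) +
                   real (n - j) * s ^ j * t ^ (n - j - 1))) +
                 ((a + 1) * t + (b + 1) * s) * (?d j * s ^ j * t ^ (n - j)) =
        ?d j * (real j + a + 1) * s ^ j * t ^ (Suc n - j) +
        ?d j * (real n - real j + b + 1) * s ^ Suc j * t ^ (Suc n - Suc j)" if "j \<le> n" for j
  proof -
    have 1: "s * (real j * s ^ (j - 1)) = real j * s ^ j"
      by (cases j) auto
    have 2: "t * (real (n - j) * t ^ (n - j - 1)) = (real n - real j) * t ^ (n - j)"
      using that by (cases "n - j") (auto simp: of_nat_diff)
    have 3: "t ^ (Suc n - j) = t * t ^ (n - j)"
      using that by (simp add: Suc_diff_le)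
    have "s * t * (?d j * (real j * s ^ (j - 1) * t ^ (n - j) +
                   real (n - j) * s ^ j * t ^ (n - j - 1))) =
          ?d j * t * t ^ (n - j) * (s * (real j * s ^ (j - 1))) +
          ?d j * s * s ^ j * (t * (real (n - j) * t ^ (n - j - 1)))"
      by (simp add: algebra_simps)
    also have "\<dots> = ?d j * t * t ^ (n - j) * (real j * s ^ j) +
          ?d j * s * s ^ j * ((real n - real j) * t ^ (n - j))"
      by (simp only: 1 2)
    finally show ?thesis
      unfolding 3 by (simp add: algebra_simps)
  qed
  have "s * t * (2 * p') + ((a + 1) * t + (b + 1) * s) * ?p =
        (\<Sum>j\<le>n. ?d j * (real j + a + 1) * s ^ j * t ^ (Suc n - j)) +
        (\<Sum>j\<le>n. ?d j * (real n - real j + b + 1) * s ^ Suc j * t ^ (Suc n - Suc j))"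
  proof -
    have "s * t * (2 * p') + ((a + 1) * t + (b + 1) * s) * ?p =
      (\<Sum>j\<le>n. s * t * (?d j * (real j * s ^ (j - 1) * t ^ (n - j) +
                   real (n - j) * s ^ j * t ^ (n - j - 1))) +
                 ((a + 1) * t + (b + 1) * s) * (?d j * s ^ j * t ^ (n - j)))"
      unfolding p p'_def sum.distrib sum_distrib_left [symmetric] by simp
    also have "\<dots> = (\<Sum>j\<le>n. ?d j * (real j + a + 1) * s ^ j * t ^ (Suc n - j) +
        ?d j * (real n - real j + b + 1) * s ^ Suc j * t ^ (Suc n - Suc j))"
      by (intro sum.cong refl summand) simp
    finally show ?thesis
      unfolding sum.distrib .
  qed
  also have "(\<Sum>j\<le>n. ?d j * (real j + a + 1) * s ^ j * t ^ (Suc n - j)) =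
             (\<Sum>j\<le>n. ?c j * real (Suc n - j) * s ^ j * t ^ (Suc n - j))"
    by (intro sum.cong refl) (simp only: jacobi_coeff_Suc_same atMost_iff)
  also have "\<dots> = (\<Sum>j\<le>Suc n. ?c j * real (Suc n - j) * s ^ j * t ^ (Suc n - j))"
    by simp
  also have "(\<Sum>j\<le>n. ?d j * (real n - real j + b + 1) * s ^ Suc j * t ^ (Suc n - Suc j)) =
             (\<Sum>j\<le>n. ?c (Suc j) * real (Suc j) * s ^ Suc j * t ^ (Suc n - Suc j))"
    by (intro sum.cong refl) (simp only: jacobi_coeff_Suc_lower atMost_iff)
  also have "\<dots> = (\<Sum>j\<le>Suc n. ?c j * real j * s ^ j * t ^ (Suc n - j))"
    by (subst sum.atMost_Suc_shift) simp
  also have "(\<Sum>j\<le>Suc n. ?c j * real (Suc n - j) * s ^ j * t ^ (Suc n - j)) + \<dots> =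
             (\<Sum>j\<le>Suc n. ?c j * real (Suc n) * s ^ j * t ^ (Suc n - j))"
    unfolding sum.distrib [symmetric]
    by (intro sum.cong refl) (auto simp: of_nat_diff algebra_simps)
  also have "\<dots> = real (Suc n) * jacobiP (Suc n) a b x"
    unfolding jacobiP_altdef s_def t_def sum_distrib_left
    by (intro sum.cong refl) (simp add: mult_ac)
  finally have eq: "s * t * (2 * p') + ((a + 1) * t + (b + 1) * s) * ?p =
      real (Suc n) * jacobiP (Suc n) a b x" .
  have st: "1 - x\<^sup>2 = -4 * s * t" "1 + x = 2 * t" "1 - x = - 2 * s"
    by (simp_all add: s_def t_def power2_eq_square field_simps)
  show ?thesis
  proof (rule that[of p'])
    show "(jacobiP n (a + 1) (b + 1) has_real_derivative p') (at x)"
      using jacobiP_deriv_sum[of n "a + 1" "b + 1" x] by (simp add: p'_def s_def t_def)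
    have "(1 - x\<^sup>2) * p' = -2 * (s * t * (2 * p'))"
      unfolding st by simp
    also have "\<dots> = 2 * ((a + 1) * t + (b + 1) * s) * ?p - 2 * real (Suc n) * jacobiP (Suc n) a b x"
      using eq by (simp add: algebra_simps)
    finally show "(1 - x\<^sup>2) * p' = ((a + 1) * (1 + x) - (b + 1) * (1 - x)) * ?p
           - 2 * real (Suc n) * jacobiP (Suc n) a b x"
      unfolding st by (simp add: algebra_simps)
  qed
qed

lemma continuous_jacobiP [continuous_intros]:
  assumes "continuous_on S f"
  shows "continuous_on S (\<lambda>x. jacobiP n a b (f x))"
  unfolding jacobiP_def using assms by (intro continuous_intros) auto

lemma jacobiP_reflect: "jacobiP k a b (-x) = (-1) ^ k * jacobiP k b a x"
proof -
  have "jacobiP k a b (-x) =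
     (\<Sum>s\<le>k. ((real k + a) gchoose (k - s)) * ((real k + b) gchoose s)
       * ((- x - 1) / 2) ^ s * ((- x + 1) / 2) ^ (k - s))"
    by (simp add: jacobiP_def)
  also have "\<dots> = (\<Sum>s\<le>k. ((real k + a) gchoose s) * ((real k + b) gchoose (k - s))
       * ((- x - 1) / 2) ^ (k - s) * ((- x + 1) / 2) ^ s)"
    by (rule sum.reindex_bij_witness[of _ "\<lambda>s. k - s" "\<lambda>s. k - s"]) auto
  also have "\<dots> = (\<Sum>s\<le>k. (-1) ^ k * (((real k + b) gchoose (k - s)) * ((real k + a) gchoose s)
       * ((x - 1) / 2) ^ s * ((x + 1) / 2) ^ (k - s)))"
  proof (intro sum.cong refl)
    fix s assume "s \<in> {..k}"
    have "((- x - 1) / 2) ^ (k - s) * ((- x + 1) / 2) ^ s =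
          (- ((x + 1) / 2)) ^ (k - s) * (- ((x - 1) / 2)) ^ s"
    proof -
      have "(- x - 1) / 2 = - ((x + 1) / 2)" "(- x + 1) / 2 = - ((x - 1) / 2)"
        by (simp_all add: field_simps)
      thus ?thesis
        by (simp only:)
    qed
    also have "\<dots> = (-1) ^ (k - s + s) * (((x + 1) / 2) ^ (k - s) * ((x - 1) / 2) ^ s)"
      by (simp only: power_minus[of "(x + 1) / 2"] power_minus[of "(x - 1) / 2"] power_add mult_ac)
    finally have "((- x - 1) / 2) ^ (k - s) * ((- x + 1) / 2) ^ s =
      (-1) ^ k * (((x + 1) / 2) ^ (k - s) * ((x - 1) / 2) ^ s)"
      using \<open>s \<in> {..k}\<close> by simp
    thus "((real k + a) gchoose s) * ((real k + b) gchoose (k - s))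
       * ((- x - 1) / 2) ^ (k - s) * ((- x + 1) / 2) ^ s =
      (-1) ^ k * (((real k + b) gchoose (k - s)) * ((real k + a) gchoose s)
       * ((x - 1) / 2) ^ s * ((x + 1) / 2) ^ (k - s))"
      by (simp add: mult.assoc)
  qed
  finally show ?thesis
    by (simp add: jacobiP_def sum_distrib_left)
qed

section \<open>Jacobi weights and the squared norm as an integral\<close>

definition jacobi_weight :: "real \<Rightarrow> real \<Rightarrow> real \<Rightarrow> real" where
  "jacobi_weight a b x = (1 - x) powr a * (1 + x) powr b"

lemma jacobi_weight_nonneg [simp]: "0 \<le> jacobi_weight a b x"
  by (simp add: jacobi_weight_def)

lemma jacobi_weight_pos: "\<bar>x\<bar> < 1 \<Longrightarrow> 0 < jacobi_weight a b x"
  by (simp add: jacobi_weight_def)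

lemma jacobi_weight_one [simp]: "jacobi_weight a b 1 = 0"
  and jacobi_weight_minus_one [simp]: "jacobi_weight a b (-1) = 0"
  by (simp_all add: jacobi_weight_def)

lemma jacobi_weight_add_one:
  assumes "\<bar>x\<bar> < 1"
  shows "jacobi_weight (a + 1) (b + 1) x = (1 - x\<^sup>2) * jacobi_weight a b x"
  using assms by (simp add: jacobi_weight_def powr_add power2_eq_square algebra_simps)

lemma jacobi_weight_add_half:
  assumes "\<bar>x\<bar> < 1"
  shows "jacobi_weight (a + 1/2) (b + 1/2) x = sqrt (1 - x\<^sup>2) * jacobi_weight a b x"
proof -
  have "1 - x\<^sup>2 = (1 - x) * (1 + x)"
    by (simp add: power2_eq_square algebra_simps)
  thus ?thesis
    using assms by (simp add: jacobi_weight_def powr_add powr_half_sqrt real_sqrt_mult)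
qed

lemma continuous_on_jacobi_weight [continuous_intros]:
  assumes "a > 0" "b > 0" "S \<subseteq> {-1..1}"
  shows "continuous_on S (jacobi_weight a b)"
  unfolding jacobi_weight_def [abs_def] using assms
  by (intro continuous_intros continuous_on_powr') auto

lemma has_real_derivative_jacobi_weight [derivative_intros]:
  assumes "\<bar>x\<bar> < 1"
  shows "(jacobi_weight a b has_real_derivative
           jacobi_weight a b x * (b * (1 - x) - a * (1 + x)) / (1 - x\<^sup>2)) (at x)"
proof -
  have pos: "1 - x > 0" "1 + x > 0"
    using assms by auto
  have "((\<lambda>x. (1 - x) powr a * (1 + x) powr b) has_real_derivative
           (1 - x) powr a * (b * (1 + x) powr (b - 1)) - a * (1 - x) powr (a - 1) * (1 + x) powr b)
           (at x)"
    using pos by (auto intro!: derivative_eq_intros simp: algebra_simps)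
  also have "(1 - x) powr a * (b * (1 + x) powr (b - 1)) - a * (1 - x) powr (a - 1) * (1 + x) powr b =
    jacobi_weight a b x * (b * (1 - x) - a * (1 + x)) / ((1 - x) * (1 + x))"
    using pos by (simp add: jacobi_weight_def powr_diff field_simps)
  also have "(1 - x) * (1 + x) = 1 - x\<^sup>2"
    by (simp add: power2_eq_square algebra_simps)
  finally show ?thesis
    by (simp add: jacobi_weight_def [abs_def])
qed

lemma Gamma_plus1_pos:
  fixes x :: real
  assumes "x > 0"
  shows "Gamma (x + 1) = x * Gamma x"
proof (rule Gamma_plus1)
  show "x \<notin> \<int>\<^sub>\<le>\<^sub>0"
    using assms by (auto elim!: nonpos_Ints_cases)
qed

lemma has_integral_jacobi_weight:
  assumes "a > 0" "b > 0"
  shows "(jacobi_weight a b has_integral jacobi_h2 0 a b) {-1..1}"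
proof -
  have "((\<lambda>t. t powr b * (1 - t) powr a) has_integral Beta (b + 1) (a + 1)) (cbox 0 1)"
    using has_integral_Beta_real[of "b + 1" "a + 1"] assms by simp
  from has_integral_affinity'[OF this, of "1/2" "1/2"]
  have "((\<lambda>x. (1/2 + x/2) powr b * (1/2 - x/2) powr a) has_integral 2 * Beta (b + 1) (a + 1)) {-1..1}"
    by (simp add: algebra_simps)
  hence "((\<lambda>x. 2 powr (a + b) * ((1/2 + x/2) powr b * (1/2 - x/2) powr a)) has_integral
          2 powr (a + b) * (2 * Beta (b + 1) (a + 1))) {-1..1}"
    by (rule has_integral_mult_right)
  hence "(jacobi_weight a b has_integral 2 powr (a + b) * (2 * Beta (b + 1) (a + 1))) {-1..1}"
  proof (rule has_integral_eq[rotated])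
    fix x :: real assume "x \<in> {-1..1}"
    hence "(1/2 + x/2) powr b = (1 + x) powr b / 2 powr b"
          "(1/2 - x/2) powr a = (1 - x) powr a / 2 powr a"
      by (simp_all add: powr_divide [symmetric] field_simps)
    thus "2 powr (a + b) * ((1/2 + x/2) powr b * (1/2 - x/2) powr a) = jacobi_weight a b x"
      by (simp add: jacobi_weight_def powr_add)
  qed
  moreover have "Gamma (a + b + 2) = (a + b + 1) * Gamma (a + b + 1)"
    using Gamma_plus1_pos[of "a + b + 1"] assms by (simp add: add_ac)
  hence "2 powr (a + b) * (2 * Beta (b + 1) (a + 1)) = jacobi_h2 0 a b"
    using assms by (simp add: jacobi_h2_def Beta_def powr_add add_ac)
  ultimately show ?thesis
    by simp
qed

text \<open>The ratio of norms that integration by parts produces; it drives the induction on the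
  degree in the norm integral.\<close>

lemma jacobi_h2_Suc:
  assumes "a > 0" "b > 0"
  shows "(real n + a + b + 2) / 4 * jacobi_h2 n (a + 1) (b + 1) =
         real (Suc n) * jacobi_h2 (Suc n) a b"
proof -
  define g1 g2 where "g1 = Gamma (real n + a + 2)" and "g2 = Gamma (real n + b + 2)"
  define G where "G = Gamma (real n + a + b + 2)"
  define L H where "L = real n + a + b + 2" and "H = 2 * real n + a + b + 3"
  have Gam: "Gamma (real n + a + b + 3) = L * G"
    using Gamma_plus1_pos[of "real n + a + b + 2"] assms by (simp add: G_def L_def add_ac)
  have "G > 0" "L > 0" "H > 0"
    using assms by (auto simp: G_def L_def H_def intro!: Gamma_real_pos)
  hence "L / 4 * (4 * T * g1 * g2 / (H * f * (L * G))) = S * (T * g1 * g2 / (H * (S * f) * G))"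
    if "S > 0" "f > 0" for S T f
    using that by (simp add: divide_simps)
  from this[of "real (Suc n)" "fact n" "2 powr (a + b + 1)"]
  have "L / 4 * (4 * 2 powr (a + b + 1) * g1 * g2 / (H * fact n * (L * G))) =
    real (Suc n) * (2 powr (a + b + 1) * g1 * g2 / (H * (real (Suc n) * fact n) * G))"
    by simp
  moreover have "2 powr (a + b + 3) = 4 * (2 powr (a + b + 1) :: real)"
    by (simp add: powr_add)
  hence "jacobi_h2 n (a + 1) (b + 1) =
      4 * 2 powr (a + b + 1) * g1 * g2 / (H * fact n * (L * G))"
    unfolding Gam [symmetric] by (simp add: jacobi_h2_def g1_def g2_def H_def add_ac)
  moreover have "jacobi_h2 (Suc n) a b =
      2 powr (a + b + 1) * g1 * g2 / (H * (real (Suc n) * fact n) * G)"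
    by (simp add: jacobi_h2_def g1_def g2_def G_def H_def add_ac)
  ultimately show ?thesis
    by (simp only: L_def)
qed

lemma jacobi_h2_pos:
  assumes "a > 0" "b > 0"
  shows "jacobi_h2 k a b > 0"
  using assms by (auto simp: jacobi_h2_def intro!: divide_pos_pos mult_pos_pos Gamma_real_pos)

text \<open>The recursion \<open>k \<rightarrow> k - 1, (a, b) \<rightarrow> (a + 1, b + 1)\<close> is integration by parts applied to
  the self-adjoint form of the Jacobi equation; it ends at a Beta integral.\<close>

theorem has_integral_jacobiP_squared:
  assumes "a > 0" "b > 0"
  shows "((\<lambda>x. jacobi_weight a b x * (jacobiP k a b x)\<^sup>2) has_integral jacobi_h2 k a b) {-1..1}"
  using assms
proof (induction k arbitrary: a b)
  case 0
  show ?case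
    using has_integral_jacobi_weight[OF 0] by (simp add: jacobiP_def)
next
  case (Suc n)
  define l where "l = real n + a + b + 2"
  have l: "l > 0"
    using Suc.prems by (simp add: l_def)
  let ?P = "jacobiP (Suc n) a b" and ?p = "jacobiP n (a + 1) (b + 1)"
  let ?w = "jacobi_weight a b" and ?w1 = "jacobi_weight (a + 1) (b + 1)"
  let ?\<Phi> = "\<lambda>x. ?w1 x * (?P x * ?p x)"
  have 1: "((\<lambda>x. l / 2 * (?w1 x * (?p x)\<^sup>2) - 2 * real (Suc n) * (?w x * (?P x)\<^sup>2))
          has_integral (?\<Phi> 1 - ?\<Phi> (-1))) {-1..1}"
  \<comment> \<open>The derivative of the weight is available only inside the interval. Continuity
    suffices at the endpoints, where the vanishing weight kills the boundary terms.\<close>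
  proof (rule fundamental_theorem_of_calculus_interior)
    show "continuous_on {-1..1} ?\<Phi>"
      using Suc.prems by (intro continuous_intros) auto
    fix x :: real assume "x \<in> {-1<..<1}"
    hence x: "\<bar>x\<bar> < 1" by auto
    hence x2: "1 - x\<^sup>2 > 0"
      by (simp add: abs_square_less_1)
    obtain p' where p': "(?p has_real_derivative p') (at x)"
      "(1 - x\<^sup>2) * p' = ((a + 1) * (1 + x) - (b + 1) * (1 - x)) * ?p x - 2 * real (Suc n) * ?P x"
      by (rule jacobiP_raising)
    have w1: "?w1 x = (1 - x\<^sup>2) * ?w x"
      using x by (rule jacobi_weight_add_one)
    have "(?\<Phi> has_real_derivative
        ?w1 x * ((b + 1) * (1 - x) - (a + 1) * (1 + x)) / (1 - x\<^sup>2) * (?P x * ?p x) +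
        (l / 2 * ?p x * ?p x + p' * ?P x) * ?w1 x) (at x)"
      unfolding l_def by (rule derivative_intros p' x has_real_derivative_jacobiP)+
    also have "?w1 x * ((b + 1) * (1 - x) - (a + 1) * (1 + x)) / (1 - x\<^sup>2) * (?P x * ?p x) +
        (l / 2 * ?p x * ?p x + p' * ?P x) * ?w1 x =
        ?w x * ((b + 1) * (1 - x) - (a + 1) * (1 + x)) * (?P x * ?p x) +
        l / 2 * (?w1 x * (?p x)\<^sup>2) + ?w x * ?P x * ((1 - x\<^sup>2) * p')"
    proof -
      have "D * w * c / D * (P * q) + (l / 2 * q * q + p' * P) * (D * w) =
          w * c * (P * q) + l / 2 * (D * w * q\<^sup>2) + w * P * (D * p')"
        if "D \<noteq> 0" for D w c P q
        using that by (simp add: power2_eq_square algebra_simps)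
      from this[OF less_imp_neq[OF x2, THEN not_sym]] show ?thesis
        unfolding w1 .
    qed
    also have "\<dots> = l / 2 * (?w1 x * (?p x)\<^sup>2) - 2 * real (Suc n) * (?w x * (?P x)\<^sup>2)"
      unfolding p'(2) by (simp add: power2_eq_square algebra_simps)
    finally show "(?\<Phi> has_vector_derivative
        l / 2 * (?w1 x * (?p x)\<^sup>2) - 2 * real (Suc n) * (?w x * (?P x)\<^sup>2)) (at x)"
      by (simp add: has_real_derivative_iff_has_vector_derivative)
  qed auto
  have 2: "((\<lambda>x. l / 2 * (?w1 x * (?p x)\<^sup>2)) has_integral
      l / 2 * jacobi_h2 n (a + 1) (b + 1)) {-1..1}"
    using Suc.prems by (intro has_integral_mult_right Suc.IH) auto
  have "((\<lambda>x. l / 2 * (?w1 x * (?p x)\<^sup>2) - (l / 2 * (?w1 x * (?p x)\<^sup>2) -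
      2 * real (Suc n) * (?w x * (?P x)\<^sup>2))) has_integral
      l / 2 * jacobi_h2 n (a + 1) (b + 1) - (?\<Phi> 1 - ?\<Phi> (-1))) {-1..1}"
    by (rule has_integral_diff[OF 2 1])
  moreover have "l / 2 * jacobi_h2 n (a + 1) (b + 1) - (?\<Phi> 1 - ?\<Phi> (-1)) =
      2 * real (Suc n) * jacobi_h2 (Suc n) a b"
    using jacobi_h2_Suc[OF Suc.prems, of n] by (simp add: l_def algebra_simps)
  ultimately have "((\<lambda>x. 2 * real (Suc n) * (?w x * (?P x)\<^sup>2)) has_integral
      2 * real (Suc n) * jacobi_h2 (Suc n) a b) {-1..1}"
    by (simp only: diff_diff_eq2 add_diff_cancel_left')
  thus ?case
    using has_integral_cmul_iff[of "2 * real (Suc n)"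
      "\<lambda>x. ?w x * (?P x)\<^sup>2" "jacobi_h2 (Suc n) a b" "{-1..1}"]
    by (simp del: of_nat_Suc)
qed

subsection \<open>Liouville form of the Jacobi equation\<close>

text \<open>Parameters above 1/2 make \<open>a\<^sup>2 - 1/4\<close> and
  \<open>b\<^sup>2 - 1/4\<close> positive, and the weight exponents in the energy \<open>E\<close>
  too, so that \<open>E\<close> is continuous and zero at both endpoints.\<close>

locale jacobi =
  fixes k :: nat and a b :: real
  assumes k: "k > 0" and a: "a > 1/2" and b: "b > 1/2"
begin

definition P :: "real \<Rightarrow> real" where
  "P = jacobiP k a b"

definition P' :: "real \<Rightarrow> real" where
  "P' x = (real k + a + b + 1) / 2 * jacobiP (k - 1) (a + 1) (b + 1) x"

definition N :: real where
  "N = real k + (a + b + 1) / 2"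

text \<open>This is \<open>(1 - x\<^sup>2) * Q x\<close>, a quadratic polynomial without the poles
  of Q.\<close>

definition Z :: "real \<Rightarrow> real" where
  "Z x = N\<^sup>2 * (1 - x\<^sup>2) - (a\<^sup>2 - 1/4) * (1 + x) / 2 - (b\<^sup>2 - 1/4) * (1 - x) / 2"

definition Z' :: "real \<Rightarrow> real" where
  "Z' x = - 2 * N\<^sup>2 * x - (a\<^sup>2 - 1/4) / 2 + (b\<^sup>2 - 1/4) / 2"

text \<open>\<open>(1 - x\<^sup>2)\<close> times half the logarithmic derivative of the weight in
  \<open>F\<close>.\<close>

definition \<sigma> :: "real \<Rightarrow> real" where
  "\<sigma> x = ((b + 1/2) * (1 - x) - (a + 1/2) * (1 + x)) / 2"

text \<open>A polynomial stand-in for du/d\<theta>, which equals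
  \<open>- R x / sqrt (1 - x\<^sup>2)\<close> times the square root of the weight in
  \<open>F\<close>. Accordingly \<open>g\<close> below is -u du/d\<theta>.\<close>

definition R :: "real \<Rightarrow> real" where
  "R x = (1 - x\<^sup>2) * P' x + \<sigma> x * P x"

abbreviation w :: "real \<Rightarrow> real" where
  "w \<equiv> jacobi_weight a b"

definition F :: "real \<Rightarrow> real" where
  "F x = jacobi_weight (a + 1/2) (b + 1/2) x * (P x)\<^sup>2"

definition g :: "real \<Rightarrow> real" where
  "g x = w x * (P x * R x)"

text \<open>The energy u'^2 + Q u^2 in the variable \<theta>, with the factor 1/(1 - x^2) moved into
  the weight.\<close>

definition E :: "real \<Rightarrow> real" where
  "E x = jacobi_weight (a - 1/2) (b - 1/2) x * (Z x * (P x)\<^sup>2 + (R x)\<^sup>2)"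

lemma pos_1_minus_sq: "\<bar>x\<bar> < 1 \<Longrightarrow> 0 < 1 - x\<^sup>2" for x :: real
  by (simp add: abs_square_less_1)

lemma deriv_P: "(P has_real_derivative P' x) (at x)"
  using has_real_derivative_jacobiP[of "k - 1" a b x] k
  by (simp add: P_def P'_def add_ac)

lemma deriv_P':
  obtains P'' where "(P' has_real_derivative P'') (at x)"
    "(1 - x\<^sup>2) * P'' = ((a + 1) * (1 + x) - (b + 1) * (1 - x)) * P' x
       - real k * (real k + a + b + 1) * P x"
proof -
  obtain p' where p': "(jacobiP (k - 1) (a + 1) (b + 1) has_real_derivative p') (at x)"
    "(1 - x\<^sup>2) * p' = ((a + 1) * (1 + x) - (b + 1) * (1 - x)) * jacobiP (k - 1) (a + 1) (b + 1) x
           - 2 * real (Suc (k - 1)) * jacobiP (Suc (k - 1)) a b x"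
    by (rule jacobiP_raising)
  define l where "l = (real k + a + b + 1) / 2"
  show ?thesis
  proof (rule that)
    show "(P' has_real_derivative l * p') (at x)"
      unfolding P'_def l_def by (intro DERIV_cmult p')
    have "(1 - x\<^sup>2) * (l * p') = l * ((1 - x\<^sup>2) * p')"
      by simp
    also have "\<dots> = ((a + 1) * (1 + x) - (b + 1) * (1 - x)) *
        (l * jacobiP (k - 1) (a + 1) (b + 1) x) - 2 * real k * l * P x"
      unfolding p'(2) using k by (simp add: P_def algebra_simps)
    finally show "(1 - x\<^sup>2) * (l * p') = ((a + 1) * (1 + x) - (b + 1) * (1 - x)) * P' x
       - real k * (real k + a + b + 1) * P x"
      by (simp add: l_def P'_def)
  qed
qed

lemma deriv_R:
  obtains R' where "(R has_real_derivative R') (at x)"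
    "(1 - x\<^sup>2) * R' = - Z x * P x - (\<sigma> x + x) * R x"
proof -
  obtain P'' where P'': "(P' has_real_derivative P'') (at x)"
    "(1 - x\<^sup>2) * P'' = ((a + 1) * (1 + x) - (b + 1) * (1 - x)) * P' x
       - real k * (real k + a + b + 1) * P x"
    by (rule deriv_P')
  have \<sigma>': "(\<sigma> has_real_derivative - (a + b + 1) / 2) (at x)"
    unfolding \<sigma>_def by (auto intro!: derivative_eq_intros simp: field_simps)
  define R' where "R' = (1 - x\<^sup>2) * P'' - 2 * x * P' x + \<sigma> x * P' x - (a + b + 1) / 2 * P x"
  show ?thesis
  proof (rule that)
    show "(R has_real_derivative R') (at x)"
      unfolding R_def R'_def
      by (auto intro!: derivative_eq_intros \<sigma>' deriv_P P'' simp: field_simps)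
    show "(1 - x\<^sup>2) * R' = - Z x * P x - (\<sigma> x + x) * R x"
      unfolding R'_def P''(2) R_def Z_def \<sigma>_def N_def
      by (simp add: power2_eq_square field_simps)
  qed
qed

lemma deriv_Z: "(Z has_real_derivative Z' x) (at x)"
  unfolding Z_def Z'_def by (auto intro!: derivative_eq_intros simp: field_simps)

lemma deriv_w:
  assumes "\<bar>x\<bar> < 1"
  obtains w' where "(w has_real_derivative w') (at x)" "(1 - x\<^sup>2) * w' = w x * (2 * \<sigma> x + x)"
proof (rule that)
  show "(w has_real_derivative w x * (b * (1 - x) - a * (1 + x)) / (1 - x\<^sup>2)) (at x)"
    using assms by (rule has_real_derivative_jacobi_weight)
  show "(1 - x\<^sup>2) * (w x * (b * (1 - x) - a * (1 + x)) / (1 - x\<^sup>2)) = w x * (2 * \<sigma> x + x)"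
    using pos_1_minus_sq[OF assms] by (simp add: \<sigma>_def field_simps)
qed

lemma sq_P'_eq: "(1 - x\<^sup>2) * P' x = R x - \<sigma> x * P x"
  by (simp add: R_def)

lemma F_eq: "\<bar>x\<bar> < 1 \<Longrightarrow> F x = sqrt (1 - x\<^sup>2) * w x * (P x)\<^sup>2"
  by (simp add: F_def jacobi_weight_add_half)

lemma deriv_sqrt:
  assumes "\<bar>x\<bar> < 1"
  shows "((\<lambda>x. sqrt (1 - x\<^sup>2)) has_real_derivative - x / sqrt (1 - x\<^sup>2)) (at x)"
  using pos_1_minus_sq[OF assms] by (auto intro!: derivative_eq_intros simp: field_simps)

lemma deriv_g:
  assumes "\<bar>x\<bar> < 1"
  shows "(g has_real_derivative w x * ((R x)\<^sup>2 - Z x * (P x)\<^sup>2) / (1 - x\<^sup>2)) (at x)"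
proof -
  obtain w' where w': "(w has_real_derivative w') (at x)" "(1 - x\<^sup>2) * w' = w x * (2 * \<sigma> x + x)"
    using assms by (rule deriv_w)
  obtain R' where R': "(R has_real_derivative R') (at x)"
    "(1 - x\<^sup>2) * R' = - Z x * P x - (\<sigma> x + x) * R x"
    by (rule deriv_R)
  define g' where "g' = w' * (P x * R x) + (P' x * R x + R' * P x) * w x"
  have "(g has_real_derivative g') (at x)"
    unfolding g_def g'_def by (rule derivative_intros w' R' deriv_P)+
  moreover have "(1 - x\<^sup>2) * g' = w x * ((R x)\<^sup>2 - Z x * (P x)\<^sup>2)"
    using w'(2) R'(2) sq_P'_eq[of x] unfolding g'_def by algebra
  hence "g' = w x * ((R x)\<^sup>2 - Z x * (P x)\<^sup>2) / (1 - x\<^sup>2)"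
    using pos_1_minus_sq[OF assms] by (simp add: field_simps)
  ultimately show ?thesis
    by simp
qed

lemma deriv_F:
  assumes "\<bar>x\<bar> < 1"
  shows "(F has_real_derivative 2 * g x / sqrt (1 - x\<^sup>2)) (at x)"
proof -
  let ?h = "jacobi_weight (a + 1/2) (b + 1/2)"
  define h' where "h' = ?h x * ((b + 1/2) * (1 - x) - (a + 1/2) * (1 + x)) / (1 - x\<^sup>2)"
  have "(?h has_real_derivative h') (at x)"
    unfolding h'_def using assms by (rule has_real_derivative_jacobi_weight)
  define F' where "F' = h' * (P x)\<^sup>2 + (P' x * P x + P' x * P x) * ?h x"
  have "((\<lambda>x. ?h x * (P x * P x)) has_real_derivative h' * (P x * P x) + (P' x * P x + P' x * P x) * ?h x) (at x)"
    by (rule derivative_intros deriv_P \<open>(?h has_real_derivative h') (at x)\<close>)+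
  hence "(F has_real_derivative F') (at x)"
    by (simp add: F_def [abs_def] F'_def power2_eq_square)
  have "(1 - x\<^sup>2) * h' = ?h x * (2 * \<sigma> x)"
    using pos_1_minus_sq[OF assms] by (simp add: h'_def \<sigma>_def field_simps)
  hence "(1 - x\<^sup>2) * F' = ?h x * 2 * P x * R x"
    using sq_P'_eq[of x] unfolding F'_def by algebra
  moreover have "?h x * 2 * P x * R x = (1 - x\<^sup>2) * (2 * g x / sqrt (1 - x\<^sup>2))"
    using pos_1_minus_sq[OF assms] real_div_sqrt[of "1 - x\<^sup>2"]
    unfolding jacobi_weight_add_half[OF assms] g_def by (simp add: field_simps)
  ultimately have "(1 - x\<^sup>2) * F' = (1 - x\<^sup>2) * (2 * g x / sqrt (1 - x\<^sup>2))"
    by (simp only:)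
  hence "F' = 2 * g x / sqrt (1 - x\<^sup>2)"
    by (subst (asm) mult_left_cancel) (use pos_1_minus_sq[OF assms] in auto)
  with \<open>(F has_real_derivative F') (at x)\<close> show ?thesis
    by simp
qed

text \<open>By u'' = -Q u the energy changes only through Q; the bracket is the x-derivative of
  Q.\<close>

lemma deriv_E:
  assumes "\<bar>x\<bar> < 1"
  shows "(E has_real_derivative F x * ((b\<^sup>2 - 1/4) / (2 * (1 + x)\<^sup>2) - (a\<^sup>2 - 1/4) / (2 * (1 - x)\<^sup>2))) (at x)"
proof -
  let ?h = "jacobi_weight (a - 1/2) (b - 1/2)"
  define h' where "h' = ?h x * ((b - 1/2) * (1 - x) - (a - 1/2) * (1 + x)) / (1 - x\<^sup>2)"
  have h': "(?h has_real_derivative h') (at x)"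
    unfolding h'_def using assms by (rule has_real_derivative_jacobi_weight)
  obtain R' where R': "(R has_real_derivative R') (at x)"
    "(1 - x\<^sup>2) * R' = - Z x * P x - (\<sigma> x + x) * R x"
    by (rule deriv_R)
  define E' where "E' = h' * (Z x * (P x * P x) + R x * R x) +
     (Z' x * (P x * P x) + (P' x * P x + P' x * P x) * Z x + (R' * R x + R' * R x)) * ?h x"
  have "((\<lambda>x. ?h x * (Z x * (P x * P x) + R x * R x)) has_real_derivative E') (at x)"
    unfolding E'_def by (rule derivative_intros deriv_P deriv_Z R' h')+
  hence "(E has_real_derivative E') (at x)"
    by (simp add: E_def [abs_def] power2_eq_square)
  moreover have h2: "(1 - x\<^sup>2) * h' = ?h x * (2 * \<sigma> x + 2 * x)"
    using pos_1_minus_sq[OF assms] by (simp add: h'_def \<sigma>_def field_simps)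
  have "(1 - x\<^sup>2) * E' = ?h x * (P x)\<^sup>2 * (2 * x * Z x + (1 - x\<^sup>2) * Z' x)"
    using sq_P'_eq[of x] R'(2) h2 unfolding E'_def by algebra
  hence "E' = ?h x * (P x)\<^sup>2 * (2 * x * Z x + (1 - x\<^sup>2) * Z' x) / (1 - x\<^sup>2)"
    using pos_1_minus_sq[OF assms] by (simp add: field_simps)
  moreover have "?h x = jacobi_weight (a + 1/2) (b + 1/2) x / (1 - x\<^sup>2)"
    using jacobi_weight_add_one[OF assms, of "a - 1/2" "b - 1/2"] pos_1_minus_sq[OF assms]
    by (simp add: field_simps)
  ultimately have "E' = F x * ((2 * x * Z x + (1 - x\<^sup>2) * Z' x) / (1 - x\<^sup>2)\<^sup>2)"
    by (simp add: F_def power2_eq_square)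
  moreover have "(2 * x * Z x + (1 - x\<^sup>2) * Z' x) =
    ((b\<^sup>2 - 1/4) * (1 - x)\<^sup>2 - (a\<^sup>2 - 1/4) * (1 + x)\<^sup>2) / 2"
    unfolding Z_def Z'_def by (simp add: power2_eq_square field_simps)
  moreover have "(1 - x\<^sup>2)\<^sup>2 = (1 - x)\<^sup>2 * (1 + x)\<^sup>2"
    by (simp add: power2_eq_square algebra_simps)
  moreover have "1 - x \<noteq> 0" "1 + x \<noteq> 0"
    using assms by auto
  ultimately show ?thesis
    using \<open>(E has_real_derivative E') (at x)\<close> by (simp add: diff_divide_distrib)
qed

text \<open>In the variable \<open>x = cos \<theta>\<close> the function \<open>u = sqrt F\<close> satisfies \<open>u'' + Q u = 0\<close> with
  \<open>Q = Z / (1 - x\<^sup>2)\<close>. For \<open>f = sin \<theta> * \<psi>\<close> this lemma is the identity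
  \<open>(f u'\<^sup>2 - f' u u' + (f Q + f''/2) u\<^sup>2)' = (2 f' Q + f Q' + f'''/2) u\<^sup>2\<close>,
  whose boundary terms at \<open>\<plusminus>1\<close> vanish.\<close>

lemma deriv_virial:
  assumes x: "\<bar>x\<bar> < 1"
    and "(\<psi> has_real_derivative \<psi>') (at x)"
    and "(\<phi> has_real_derivative \<rho> x) (at x)"
    and "(\<rho> has_real_derivative \<rho>') (at x)"
    and \<phi>: "\<phi> x = x * \<psi> x - (1 - x\<^sup>2) * \<psi>'"
  shows "((\<lambda>x. w x * (\<psi> x * (R x * R x) + \<phi> x * (P x * R x) +
                    (Z x * \<psi> x - (1 - x\<^sup>2) * \<rho> x / 2) * (P x * P x))) has_real_derivative
          w x * (P x)\<^sup>2 * (2 * \<psi>' * Z x + \<psi> x * Z' x + (x * \<rho> x - (1 - x\<^sup>2) * \<rho>') / 2)) (at x)"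
proof -
  obtain w' where w': "(w has_real_derivative w') (at x)" "(1 - x\<^sup>2) * w' = w x * (2 * \<sigma> x + x)"
    using x by (rule deriv_w)
  obtain R' where R': "(R has_real_derivative R') (at x)"
    "(1 - x\<^sup>2) * R' = - Z x * P x - (\<sigma> x + x) * R x"
    by (rule deriv_R)
  have coeff: "((\<lambda>x. Z x * \<psi> x - (1 - x\<^sup>2) * \<rho> x / 2) has_real_derivative
      Z' x * \<psi> x + \<psi>' * Z x - (- 2 * x * \<rho> x + (1 - x\<^sup>2) * \<rho>') / 2) (at x)"
    by (auto intro!: derivative_eq_intros deriv_Z assms simp: field_simps)
  define X' where "X' = \<psi>' * (R x * R x) + (R' * R x + R' * R x) * \<psi> x +
     (\<rho> x * (P x * R x) + (P' x * R x + R' * P x) * \<phi> x) +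
     ((Z' x * \<psi> x + \<psi>' * Z x - (- 2 * x * \<rho> x + (1 - x\<^sup>2) * \<rho>') / 2) * (P x * P x) +
      (P' x * P x + P' x * P x) * (Z x * \<psi> x - (1 - x\<^sup>2) * \<rho> x / 2))"
  define J' where "J' = w' * (\<psi> x * (R x * R x) + \<phi> x * (P x * R x) +
                    (Z x * \<psi> x - (1 - x\<^sup>2) * \<rho> x / 2) * (P x * P x)) + X' * w x"
  have "((\<lambda>x. w x * (\<psi> x * (R x * R x) + \<phi> x * (P x * R x) +
                    (Z x * \<psi> x - (1 - x\<^sup>2) * \<rho> x / 2) * (P x * P x))) has_real_derivative J') (at x)"
    unfolding J'_def X'_def
    by (rule w'(1) R'(1) deriv_P assms(2-4) coeff derivative_intros)+
  moreover have "(1 - x\<^sup>2) * J' = (1 - x\<^sup>2) * 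
     (w x * (P x)\<^sup>2 * (2 * \<psi>' * Z x + \<psi> x * Z' x + (x * \<rho> x - (1 - x\<^sup>2) * \<rho>') / 2))"
  proof -
    have "2 * ((1 - x\<^sup>2) * J') = ((1 - x\<^sup>2) * w') * (2 * \<psi> x * (R x * R x) + 2 * \<phi> x * (P x * R x) +
                    (2 * Z x * \<psi> x - (1 - x\<^sup>2) * \<rho> x) * (P x * P x)) +
       w x * (2 * (1 - x\<^sup>2) * \<psi>' * (R x * R x) + 4 * ((1 - x\<^sup>2) * R') * R x * \<psi> x +
     2 * (1 - x\<^sup>2) * \<rho> x * (P x * R x) + 2 * (((1 - x\<^sup>2) * P' x) * R x + ((1 - x\<^sup>2) * R') * P x) * \<phi> x +
     (1 - x\<^sup>2) * (2 * Z' x * \<psi> x + 2 * \<psi>' * Z x - (- 2 * x * \<rho> x + (1 - x\<^sup>2) * \<rho>')) * (P x * P x) +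
      2 * ((1 - x\<^sup>2) * P' x) * P x * (2 * Z x * \<psi> x - (1 - x\<^sup>2) * \<rho> x))"
      unfolding J'_def X'_def by (simp add: field_simps)
    also have "\<dots> = (1 - x\<^sup>2) * 
     (w x * (P x)\<^sup>2 * (4 * \<psi>' * Z x + 2 * \<psi> x * Z' x + (x * \<rho> x - (1 - x\<^sup>2) * \<rho>')))"
      unfolding w' R' sq_P'_eq \<phi> by algebra
    finally show ?thesis
      by (simp add: field_simps)
  qed
  ultimately show ?thesis
    using pos_1_minus_sq[OF x] by simp
qed

lemma isCont_P: "isCont P x"
  using deriv_P by (rule DERIV_isCont)

lemma isCont_R: "isCont R x"
  using deriv_R[of x] DERIV_isCont by metis

lemma isCont_Z: "isCont Z x"
  using deriv_Z by (rule DERIV_isCont)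

lemma continuous_on_PRZ [continuous_intros]:
  "continuous_on S P" "continuous_on S R" "continuous_on S Z"
  by (simp_all add: continuous_at_imp_continuous_on isCont_P isCont_R isCont_Z)

lemma continuous_on_w [continuous_intros]: "S \<subseteq> {-1..1} \<Longrightarrow> continuous_on S w"
  using a b by (intro continuous_intros) auto

lemma continuous_on_F: "continuous_on {-1..1} F"
  unfolding F_def [abs_def] using a b by (intro continuous_intros) auto

lemma continuous_on_E: "continuous_on {-1..1} E"
  unfolding E_def [abs_def] using a b by (intro continuous_intros) auto

lemma F_ends [simp]: "F 1 = 0" "F (-1) = 0"
  and E_ends [simp]: "E 1 = 0" "E (-1) = 0"
  by (simp_all add: F_def E_def)

lemma F_nonneg: "0 \<le> F x"
  by (simp add: F_def)

end

subsection \<open>Turning points and the location of the maximum\<close>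

context jacobi
begin

definition ctr :: real where
  "ctr = (b\<^sup>2 - a\<^sup>2) / (4 * N\<^sup>2)"

definition K :: real where
  "K = 2 * real k + 1"

text \<open>Half the distance between the turning points. The product comes from factoring
  \<open>(1 - ctr)\<^sup>2 - a\<^sup>2 / N\<^sup>2\<close> as a difference of squares, with factors
  2N \<plusminus> a \<plusminus> b; positivity and lower bounds can be read off from it.\<close>

definition rad :: real where
  "rad = sqrt (K * (K + 2 * a) * (K + 2 * b) * (K + 2 * a + 2 * b) / (16 * N ^ 4) + 1 / (4 * N\<^sup>2))"

lemma N_pos: "N > 0"
  unfolding N_def using a b by (intro add_nonneg_pos) auto

lemma K_ge: "K \<ge> 3"
  using k by (simp add: K_def)

lemma N_eq: "2 * N = K + a + b"
  by (simp add: N_def K_def)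

lemma rad_sq: "rad\<^sup>2 = K * (K + 2 * a) * (K + 2 * b) * (K + 2 * a + 2 * b) / (16 * N ^ 4) + 1 / (4 * N\<^sup>2)"
  unfolding rad_def using a b K_ge by (intro real_sqrt_pow2 add_nonneg_nonneg) auto

lemma rad_pos: "rad > 0"
  unfolding rad_def using a b K_ge N_pos
  by (intro real_sqrt_gt_zero add_pos_pos divide_pos_pos mult_pos_pos) auto

text \<open>In terms of the quadratic \<open>Z\<close> this says that its value at 1 is
  \<open>- (a\<^sup>2 - 1/4)\<close>. The negative value there, and likewise at -1, puts both
  turning points inside the open interval.\<close>

lemma rad_sq_right: "rad\<^sup>2 + (a\<^sup>2 - 1/4) / N\<^sup>2 = (1 - ctr)\<^sup>2"
proof -
  have K: "K = 2 * N - a - b"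
    using N_eq by simp
  have "16 * N ^ 4 * (rad\<^sup>2 + (a\<^sup>2 - 1/4) / N\<^sup>2) =
    K * (K + 2 * a) * (K + 2 * b) * (K + 2 * a + 2 * b) + 16 * N\<^sup>2 * a\<^sup>2"
    unfolding rad_sq using N_pos by (simp add: field_simps power2_eq_square power4_eq_xxxx)
  also have "\<dots> = 16 * N ^ 4 * (1 - ctr)\<^sup>2"
    unfolding ctr_def K using N_pos by (simp add: field_simps power2_eq_square power4_eq_xxxx)
  finally show ?thesis
    using N_pos by simp
qed

lemma rad_sq_left: "rad\<^sup>2 + (b\<^sup>2 - 1/4) / N\<^sup>2 = (1 + ctr)\<^sup>2"
proof -
  have "(1 + ctr)\<^sup>2 - (1 - ctr)\<^sup>2 = (b\<^sup>2 - 1/4) / N\<^sup>2 - (a\<^sup>2 - 1/4) / N\<^sup>2"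
    using N_pos by (simp add: ctr_def field_simps power2_eq_square)
  thus ?thesis
    using rad_sq_right by simp
qed

lemma Z_eq: "Z x = N\<^sup>2 * (rad\<^sup>2 - (x - ctr)\<^sup>2)"
proof -
  have "N\<^sup>2 * (rad\<^sup>2 - (x - ctr)\<^sup>2) = N\<^sup>2 * ((1 - ctr)\<^sup>2 - (x - ctr)\<^sup>2) - (a\<^sup>2 - 1/4)"
    using rad_sq_right N_pos by (simp add: field_simps)
  also have "\<dots> = Z x"
    using N_pos by (simp add: Z_def ctr_def field_simps power2_eq_square)
  finally show ?thesis ..
qed

lemma Z'_eq: "Z' x = 2 * N\<^sup>2 * (ctr - x)"
  using N_pos by (simp add: Z'_def ctr_def field_simps)

lemma A_pos: "a\<^sup>2 - 1/4 > 0" and B_pos: "b\<^sup>2 - 1/4 > 0"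
  using power_strict_mono[OF a, of 2] power_strict_mono[OF b, of 2]
  by (simp_all add: power_divide)

lemma ctr_bounds: "-1 < ctr" "ctr < 1"
proof -
  have "a < 2 * N" "b < 2 * N"
    using a b K_ge by (simp_all add: N_eq)
  hence "a\<^sup>2 < (2 * N)\<^sup>2" "b\<^sup>2 < (2 * N)\<^sup>2"
    using power_strict_mono[OF \<open>a < 2 * N\<close>, of 2] power_strict_mono[OF \<open>b < 2 * N\<close>, of 2] a b
    by auto
  hence "b\<^sup>2 - a\<^sup>2 < 4 * N\<^sup>2" "- (4 * N\<^sup>2) < b\<^sup>2 - a\<^sup>2"
    using A_pos B_pos by (auto simp: power_mult_distrib)
  thus "-1 < ctr" "ctr < 1"
    using N_pos by (simp_all add: ctr_def field_simps)
qed

lemma ctr_plus_rad: "ctr + rad < 1"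
proof -
  have "rad\<^sup>2 < (1 - ctr)\<^sup>2"
    unfolding rad_sq_right [symmetric] using A_pos N_pos by simp
  hence "rad < 1 - ctr"
    by (rule power2_less_imp_less) (use ctr_bounds in auto)
  thus ?thesis by simp
qed

lemma ctr_minus_rad: "-1 < ctr - rad"
proof -
  have "rad\<^sup>2 < (1 + ctr)\<^sup>2"
    unfolding rad_sq_left [symmetric] using B_pos N_pos by simp
  hence "rad < 1 + ctr"
    by (rule power2_less_imp_less) (use ctr_bounds in auto)
  thus ?thesis by simp
qed

definition Q :: "real \<Rightarrow> real" where
  "Q x = Z x / (1 - x\<^sup>2)"

definition V :: "real \<Rightarrow> real" where
  "V x = (a\<^sup>2 - 1/4) / (2 * (1 - x)\<^sup>2) - (b\<^sup>2 - 1/4) / (2 * (1 + x)\<^sup>2)"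

lemma Q_eq:
  assumes "\<bar>x\<bar> < 1"
  shows "Q x = N\<^sup>2 - (a\<^sup>2 - 1/4) / (2 * (1 - x)) - (b\<^sup>2 - 1/4) / (2 * (1 + x))"
proof -
  have *: "1 - x\<^sup>2 = (1 - x) * (1 + x)" "1 - x \<noteq> 0" "1 + x \<noteq> 0"
    using assms by (auto simp: power2_eq_square algebra_simps)
  show ?thesis
    unfolding Q_def Z_def *(1) using *(2,3) by (simp add: divide_simps) (simp add: algebra_simps)
qed

lemma deriv_Q:
  assumes "\<bar>x\<bar> < 1"
  shows "(Q has_real_derivative - V x) (at x)"
proof (rule has_field_derivative_transform_within_open)
  show "((\<lambda>x. N\<^sup>2 - (a\<^sup>2 - 1/4) / (2 * (1 - x)) - (b\<^sup>2 - 1/4) / (2 * (1 + x)))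
          has_real_derivative - V x) (at x)"
  proof -
    have ne: "1 - x \<noteq> 0" "1 + x \<noteq> 0"
      using assms by auto
    have "((\<lambda>x. C - A / (2 * (1 - x)) - B / (2 * (1 + x))) has_real_derivative
        - (A / (2 * (1 - x)\<^sup>2) - B / (2 * (1 + x)\<^sup>2))) (at x)" for A B C
      using ne by (auto intro!: derivative_eq_intros) (simp add: power2_eq_square divide_simps, (simp add: algebra_simps)?)
    thus ?thesis
      unfolding V_def .
  qed
qed (use assms in \<open>auto simp: Q_eq intro!: open_greaterThanLessThan[of "-1" 1]\<close>)

text \<open>\<open>sqrt (1 - x\<^sup>2) * V x\<close> is dQ/d\<theta>. It is a positive multiple of
  the root of (1 + x)/(1 - x)^3 minus one of the root of (1 - x)/(1 + x)^3, so a lower bound at one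
  point persists to the right.\<close>

lemma V_mono:
  assumes "-1 < x" "x \<le> y" "y < 1"
  shows "sqrt (1 - x\<^sup>2) * V x \<le> sqrt (1 - y\<^sup>2) * V y" "V x \<le> V y"
proof -
  have V': "sqrt (1 - t\<^sup>2) * V t = (a\<^sup>2 - 1/4) / 2 * sqrt ((1 + t) / (1 - t) ^ 3) -
        (b\<^sup>2 - 1/4) / 2 * sqrt ((1 - t) / (1 + t) ^ 3)" if "-1 < t" "t < 1" for t
  proof -
    define p q where "p = sqrt (1 + t)" and "q = sqrt (1 - t)"
    have pq: "p > 0" "q > 0" "p\<^sup>2 = 1 + t" "q\<^sup>2 = 1 - t"
      using that by (simp_all add: p_def q_def)
    have "1 - t\<^sup>2 = (1 - t) * (1 + t)"
      by (simp add: power2_eq_square algebra_simps)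
    hence "sqrt (1 - t\<^sup>2) = q * p"
      by (simp add: p_def q_def real_sqrt_mult)
    moreover have "sqrt ((1 + t) / (1 - t) ^ 3) = p / q ^ 3" "sqrt ((1 - t) / (1 + t) ^ 3) = q / p ^ 3"
      by (simp_all add: p_def q_def real_sqrt_divide real_sqrt_power)
    moreover have "q * p * (A / (2 * (q\<^sup>2)\<^sup>2) - B / (2 * (p\<^sup>2)\<^sup>2)) =
        A / 2 * (p / q ^ 3) - B / 2 * (q / p ^ 3)" for A B
      using pq(1,2) by (simp add: field_simps power2_eq_square power3_eq_cube)
    ultimately show ?thesis
      by (simp only: V_def pq(3,4) [symmetric])
  qed
  have "sqrt ((1 + x) / (1 - x) ^ 3) \<le> sqrt ((1 + y) / (1 - y) ^ 3)"
    using assms by (intro real_sqrt_le_mono frac_le power_mono) auto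
  moreover have "sqrt ((1 - y) / (1 + y) ^ 3) \<le> sqrt ((1 - x) / (1 + x) ^ 3)"
    using assms by (intro real_sqrt_le_mono frac_le power_mono) auto
  ultimately show "sqrt (1 - x\<^sup>2) * V x \<le> sqrt (1 - y\<^sup>2) * V y"
    using assms A_pos B_pos by (simp add: V' diff_mono mult_left_mono)
  show "V x \<le> V y"
    unfolding V_def using assms A_pos B_pos a b
    by (intro diff_mono frac_le mult_left_mono power_mono mult_pos_pos) auto
qed

text \<open>Differentiate \<open>Z = (1 - x\<^sup>2) * Q\<close>. This expresses the slope of Q by Q
  and the distance to the midpoint alone.\<close>

lemma V_eq:
  assumes "\<bar>x\<bar> < 1"
  shows "(1 - x\<^sup>2) * V x = 2 * N\<^sup>2 * (x - ctr) - 2 * x * Q x"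
proof -
  have *: "1 - x\<^sup>2 = (1 - x) * (1 + x)" "1 - x \<noteq> 0" "1 + x \<noteq> 0"
    using assms by (auto simp: power2_eq_square algebra_simps)
  have "2 * N\<^sup>2 * (x - ctr) = - Z' x"
    by (simp add: Z'_eq algebra_simps)
  moreover have "(1 - x\<^sup>2) * V x = - Z' x - 2 * x * Q x"
    unfolding Q_eq[OF assms] V_def Z'_def *(1) using *(2,3)
    by (simp add: divide_simps power2_eq_square) (simp add: algebra_simps)
  ultimately show ?thesis by simp
qed

end

section \<open>A maximum to the right of the midpoint\<close>

locale jacobi_max = jacobi +
  fixes x0 :: real
  assumes x0: "\<bar>x0\<bar> < 1"
    and F_max: "\<And>x. x \<in> {-1..1} \<Longrightarrow> F x \<le> F x0"
    and F_pos: "F x0 > 0"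
    and x0_ge: "ctr \<le> x0"
begin

abbreviation s0 :: real where "s0 \<equiv> sqrt (1 - x0\<^sup>2)"

lemma s0_pos: "s0 > 0"
  using pos_1_minus_sq[OF x0] by simp

lemma g_x0: "g x0 = 0"
proof -
  have "2 * g x0 / s0 = 0"
  proof (rule DERIV_local_max[OF deriv_F[OF x0]])
    show "0 < 1 - \<bar>x0\<bar>"
      using x0 by simp
    show "\<forall>y. \<bar>x0 - y\<bar> < 1 - \<bar>x0\<bar> \<longrightarrow> F y \<le> F x0"
      by (intro allI impI F_max) auto
  qed
  thus ?thesis
    using s0_pos by simp
qed

lemma P_x0: "P x0 \<noteq> 0"
  using F_pos by (auto simp: F_def)

lemma R_x0: "R x0 = 0"
  using g_x0 P_x0 jacobi_weight_pos[OF x0, of a b] by (simp add: g_def)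

lemma E_x0: "E x0 = Q x0 * F x0"
proof -
  have "jacobi_weight (a + 1/2) (b + 1/2) x0 = (1 - x0\<^sup>2) * jacobi_weight (a - 1/2) (b - 1/2) x0"
    using jacobi_weight_add_one[OF x0, of "a - 1/2" "b - 1/2"] by (simp add: add.commute)
  thus ?thesis
    using pos_1_minus_sq[OF x0] by (simp add: E_def Q_def F_def R_x0)
qed

text \<open>Right of the midpoint \<open>Z\<close> decreases. If it were not positive at
  \<open>x0\<close>, then \<open>F\<close> would be convex in \<theta> from \<open>x0\<close> on
  with zero initial slope, and could not fall to \<open>F 1 = 0\<close>.\<close>

lemma Z_x0_pos: "Z x0 > 0"
proof (rule ccontr)
  assume "\<not> Z x0 > 0"
  have Z: "Z x \<le> 0" if "x0 \<le> x" for x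
  proof -
    have "(x0 - ctr)\<^sup>2 \<le> (x - ctr)\<^sup>2"
      using that x0_ge by (intro power_mono) auto
    hence "Z x \<le> Z x0"
      by (simp add: Z_eq mult_left_mono)
    thus ?thesis using \<open>\<not> Z x0 > 0\<close> by simp
  qed
  have g: "g x \<ge> 0" if "x0 \<le> x" "x < 1" for x
  proof -
    have "g x0 \<le> g x"
    proof (rule DERIV_nonneg_imp_nondecreasing[OF that(1)])
      fix y assume y: "x0 \<le> y" "y \<le> x"
      hence y1: "\<bar>y\<bar> < 1"
        using x0 that by auto
      have "w y * ((R y)\<^sup>2 - Z y * (P y)\<^sup>2) / (1 - y\<^sup>2) \<ge> 0"
        using Z[OF y(1)] pos_1_minus_sq[OF y1]
        by (intro divide_nonneg_pos mult_nonneg_nonneg)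
           (auto simp: mult_nonpos_nonneg intro: order.trans[of _ 0])
      thus "\<exists>d. (g has_real_derivative d) (at y) \<and> 0 \<le> d"
        using deriv_g[OF y1] by blast
    qed
    thus ?thesis by (simp add: g_x0)
  qed
  have "F x0 \<le> F 1"
  proof (rule DERIV_nonneg_imp_increasing_open[where f = F])
    show "continuous_on {x0..1} F"
      using x0 by (intro continuous_on_subset[OF continuous_on_F]) auto
    fix x assume x: "x0 < x" "x < 1"
    hence x1: "\<bar>x\<bar> < 1" using x0 by auto
    have "2 * g x / sqrt (1 - x\<^sup>2) \<ge> 0"
      using g[of x] x pos_1_minus_sq[OF x1] by (intro divide_nonneg_nonneg) auto
    thus "\<exists>d. (F has_real_derivative d) (at x) \<and> 0 \<le> d"
      using deriv_F[OF x1] by blast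
  qed (use x0 in auto)
  thus False
    using F_pos by simp
qed

lemma Q_x0_pos: "Q x0 > 0"
  using Z_x0_pos pos_1_minus_sq[OF x0] by (simp add: Q_def)

text \<open>Since \<open>F'' \<ge> - 2 Q(x0) F(x0)\<close> in the variable \<open>arccos x\<close>, the maximum cannot be too
  narrow, and the energy \<open>E\<close> must grow from \<open>0\<close> at \<open>x = 1\<close> to \<open>Q F\<close> at \<open>x0\<close>. This keeps
  \<open>x0\<close> away from the turning point.\<close>

lemma Q_x0_ge: "Q x0 * sqrt (Q x0) \<ge> 2/3 * (s0 * V x0)"
proof (cases "V x0 > 0")
  case False
  hence "s0 * V x0 \<le> 0"
    using s0_pos by (simp add: mult_nonneg_nonpos)
  moreover have "0 \<le> Q x0 * sqrt (Q x0)"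
    using Q_x0_pos by simp
  ultimately show ?thesis
    by linarith
next
  case True
  let ?M = "F x0" and ?q = "Q x0" and ?S = "s0 * V x0"
  \<comment> \<open>Distance from \<open>x0\<close> in the variable \<theta>, positive to the right
    of \<open>x0\<close>.\<close>
  define y where "y = (\<lambda>x. arccos x0 - arccos x)"
  have S: "?S > 0"
    using True s0_pos by simp
  have V: "V x > 0" "sqrt (1 - x\<^sup>2) * V x \<ge> ?S" if "x0 \<le> x" "x < 1" for x
  proof -
    have "-1 < x0"
      using x0 by auto
    from V_mono[OF this that] show "V x > 0" "sqrt (1 - x\<^sup>2) * V x \<ge> ?S"
      using True by auto
  qed
  have Q: "Q x \<le> ?q" if "x0 \<le> x" "x < 1" for x
  proof (rule DERIV_nonpos_imp_nonincreasing[OF that(1)])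
    fix t assume "x0 \<le> t" "t \<le> x"
    thus "\<exists>d. (Q has_real_derivative d) (at t) \<and> d \<le> 0"
      using that x0 by (intro exI[of _ "- V t"] conjI deriv_Q) (auto simp: V less_imp_le)
  qed
  have y_ge: "y x \<ge> 0" if "x0 \<le> x" "x \<le> 1" for x
    using that x0 by (simp add: y_def arccos_le_arccos)
  have deriv_y: "(y has_real_derivative 1 / sqrt (1 - x\<^sup>2)) (at x)" if "\<bar>x\<bar> < 1" for x
    unfolding y_def using that
    by (auto intro!: derivative_eq_intros simp: field_simps)
  have cont_y: "continuous_on {x0..1} y"
    unfolding y_def using x0 by (intro continuous_intros) auto
  have g_ge: "g x + ?q * ?M * y x \<ge> 0" if "x0 \<le> x" "x < 1" for x
  proof -
    have "g x0 + ?q * ?M * y x0 \<le> g x + ?q * ?M * y x"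
    proof (rule DERIV_nonneg_imp_nondecreasing[OF that(1)])
      fix t assume t: "x0 \<le> t" "t \<le> x"
      hence t1: "\<bar>t\<bar> < 1"
        using x0 that by auto
      define s where "s = sqrt (1 - t\<^sup>2)"
      have s: "s > 0" "s\<^sup>2 = 1 - t\<^sup>2"
        using pos_1_minus_sq[OF t1] by (auto simp: s_def)
      have "Q t * F t \<le> ?q * ?M"
        using Q[of t] F_max[of t] t that x0 Q_x0_pos F_nonneg[of t] F_pos
        by (intro mult_mono) auto
      hence "0 \<le> (?q * ?M - Q t * F t) / s + w t * (R t)\<^sup>2 / s\<^sup>2"
        using s(1) by (intro add_nonneg_nonneg divide_nonneg_nonneg mult_nonneg_nonneg) auto
      also have "\<dots> = w t * ((R t)\<^sup>2 - Z t * (P t)\<^sup>2) / (1 - t\<^sup>2) + ?q * ?M * (1 / s)"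
        using s(1) unfolding F_eq[OF t1] Q_def[of t] s_def [symmetric] s(2) [symmetric]
        by (simp add: field_simps power2_eq_square)
      finally have "0 \<le> w t * ((R t)\<^sup>2 - Z t * (P t)\<^sup>2) / (1 - t\<^sup>2) + ?q * ?M * (1 / s)" .
      moreover have "((\<lambda>x. g x + ?q * ?M * y x) has_real_derivative
          w t * ((R t)\<^sup>2 - Z t * (P t)\<^sup>2) / (1 - t\<^sup>2) + ?q * ?M * (1 / s)) (at t)"
        unfolding s_def by (intro DERIV_add DERIV_cmult deriv_g deriv_y t1)
      ultimately show "\<exists>d. ((\<lambda>x. g x + ?q * ?M * y x) has_real_derivative d) (at t) \<and> 0 \<le> d"
        by blast
    qed
    thus ?thesis
      by (simp add: g_x0 y_def)
  qed
  \<comment> \<open>Integrating the bound on F'' a second time puts a parabola under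
    \<open>F\<close>.\<close>
  have F_ge: "F x \<ge> ?M * (1 - ?q * (y x)\<^sup>2)" if "x0 \<le> x" "x \<le> 1" for x
  proof -
    have "F x0 + ?M * ?q * (y x0)\<^sup>2 \<le> F x + ?M * ?q * (y x)\<^sup>2"
    proof (rule DERIV_nonneg_imp_increasing_open[OF that(1)])
      show "continuous_on {x0..x} (\<lambda>x. F x + ?M * ?q * (y x)\<^sup>2)"
        using x0 that
        by (intro continuous_intros continuous_on_subset[OF continuous_on_F]
              continuous_on_subset[OF cont_y]) auto
      fix t assume t: "x0 < t" "t < x"
      hence t1: "\<bar>t\<bar> < 1"
        using x0 that by auto
      define s where "s = sqrt (1 - t\<^sup>2)"
      have s: "s > 0"
        using pos_1_minus_sq[OF t1] by (auto simp: s_def)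
      have "((\<lambda>x. F x + ?M * ?q * (y x)\<^sup>2) has_real_derivative
          2 * g t / s + ?M * ?q * (real 2 * (1 / s * y t ^ (2 - Suc 0)))) (at t)"
        unfolding s_def by (intro DERIV_add DERIV_cmult DERIV_power deriv_F deriv_y t1)
      moreover have "2 * g t / s + ?M * ?q * (real 2 * (1 / s * y t ^ (2 - Suc 0))) =
          2 * (g t + ?q * ?M * y t) / s"
        using s by (simp add: field_simps)
      moreover have "\<dots> \<ge> 0"
        using g_ge[of t] t that s by (intro divide_nonneg_pos) auto
      ultimately show "\<exists>d. ((\<lambda>x. F x + ?M * ?q * (y x)\<^sup>2) has_real_derivative d) (at t) \<and> 0 \<le> d"
        by metis
    qed
    thus ?thesis
      by (simp add: y_def algebra_simps)
  qed
  \<comment> \<open>At distance \<open>r\<close> the parabola vanishes. Since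
    \<open>F 1 = 0\<close>, the interval of that length fits between \<open>x0\<close> and
    1.\<close>
  define r where "r = 1 / sqrt ?q"
  have r: "r > 0" "?q * r\<^sup>2 = 1"
    using Q_x0_pos by (simp_all add: r_def power_divide)
  have "0 \<ge> ?M * (1 - ?q * (y 1)\<^sup>2)"
    using F_ge[of 1] x0 by simp
  hence "?q * r\<^sup>2 \<le> ?q * (y 1)\<^sup>2"
    using F_pos r by (simp add: mult_le_0_iff)
  hence "r \<le> arccos x0"
    using Q_x0_pos y_ge[of 1] x0 by (simp add: y_def abs_le_square_iff [symmetric])
  define x1 where "x1 = cos (arccos x0 - r)"
  have arccos_pi: "0 \<le> arccos x0" "arccos x0 \<le> pi"
    using x0 by (auto intro!: arccos_lbound arccos_ubound)
  have y1: "y x1 = r"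
    using r \<open>r \<le> arccos x0\<close> arccos_pi by (simp add: y_def x1_def arccos_cos)
  have "cos (arccos x0) \<le> x1"
    unfolding x1_def using r \<open>r \<le> arccos x0\<close> arccos_pi by (intro cos_monotone_0_pi_le) auto
  hence x1: "x0 \<le> x1" "x1 \<le> 1"
    using x0 by (auto simp: x1_def)
  have E1: "E x1 \<ge> E 1"
  proof (rule DERIV_nonpos_imp_decreasing_open[OF x1(2)])
    show "continuous_on {x1..1} E"
      using x0 x1 by (intro continuous_on_subset[OF continuous_on_E]) auto
    fix t assume t: "x1 < t" "t < 1"
    hence t1: "\<bar>t\<bar> < 1" using x0 x1 by auto
    have "F t * (- V t) \<le> 0"
      using F_nonneg[of t] V(1)[of t] t x1 by (intro mult_nonneg_nonpos) auto
    thus "\<exists>d. (E has_real_derivative d) (at t) \<and> d \<le> 0"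
      using deriv_E[OF t1] by (auto simp: V_def)
  qed
  \<comment> \<open>The energy slope is at least \<open>?S * ?M * (1 - ?q * y^2)\<close>. Its
    integral over [0, r] is \<open>?S * ?M * (r - ?q * r ^ 3 / 3)\<close>, and
    \<open>?q * r\<^sup>2 = 1\<close> turns this into 2/3 of \<open>?S * ?M * r\<close>.\<close>
  have "E x1 + ?S * ?M * (y x1 - ?q * (y x1) ^ 3 / 3) \<le> E x0 + ?S * ?M * (y x0 - ?q * (y x0) ^ 3 / 3)"
  proof (rule DERIV_nonpos_imp_decreasing_open[OF x1(1)])
    show "continuous_on {x0..x1} (\<lambda>x. E x + ?S * ?M * (y x - ?q * (y x) ^ 3 / 3))"
      using x0 x1
      by (intro continuous_intros continuous_on_subset[OF continuous_on_E]
            continuous_on_subset[OF cont_y]) auto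
    fix t assume t: "x0 < t" "t < x1"
    hence t1: "\<bar>t\<bar> < 1" using x0 x1 by auto
    define s where "s = sqrt (1 - t\<^sup>2)"
    have s: "s > 0"
      using pos_1_minus_sq[OF t1] by (auto simp: s_def)
    have deriv: "((\<lambda>x. E x + ?S * ?M * (y x - ?q * (y x) ^ 3 / 3)) has_real_derivative
        F t * (- V t) + ?S * ?M * (1 / s - ?q * (real 3 * (1 / s * y t ^ (3 - Suc 0))) / 3)) (at t)"
      using deriv_E[OF t1] unfolding s_def
      by (intro DERIV_add DERIV_cmult DERIV_diff DERIV_cdivide DERIV_power deriv_y t1)
         (simp add: V_def)
    have eq: "F t * (- V t) + ?S * ?M * (1 / s - ?q * (real 3 * (1 / s * y t ^ (3 - Suc 0))) / 3) =
        (?S * (?M * (1 - ?q * (y t)\<^sup>2)) - s * V t * F t) / s"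
      using s by (simp add: field_simps)
    have "?S * (?M * (1 - ?q * (y t)\<^sup>2)) \<le> s * V t * F t"
    proof -
      have "y t \<le> y x1"
        using t x0 x1 by (simp add: y_def arccos_le_arccos)
      hence "(y t)\<^sup>2 \<le> r\<^sup>2"
        using y_ge[of t] t x1 y1 by (intro power_mono) auto
      hence "?q * (y t)\<^sup>2 \<le> 1"
        using Q_x0_pos r(2) by (metis less_imp_le mult_left_mono)
      hence nonneg: "0 \<le> ?M * (1 - ?q * (y t)\<^sup>2)"
        using F_pos by simp
      have S_le: "?S \<le> s * V t"
        using V(2)[of t] t x1 by (simp add: s_def)
      have F_ge': "?M * (1 - ?q * (y t)\<^sup>2) \<le> F t"
        using F_ge[of t] t x1 by simp
      show ?thesis
        using S S_le by (intro mult_mono[OF S_le F_ge' _ nonneg]) linarith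
    qed
    hence "(?S * (?M * (1 - ?q * (y t)\<^sup>2)) - s * V t * F t) / s \<le> 0"
      using s by (simp add: divide_nonpos_pos)
    thus "\<exists>d. ((\<lambda>x. E x + ?S * ?M * (y x - ?q * (y x) ^ 3 / 3)) has_real_derivative d) (at t) \<and> d \<le> 0"
      using deriv unfolding eq by blast
  qed
  hence "?S * ?M * (r - ?q * r ^ 3 / 3) \<le> ?q * ?M"
    using E1 unfolding y1 by (simp add: E_x0 y_def)
  hence "?S * (r - ?q * r ^ 3 / 3) \<le> ?q"
    using F_pos by (simp add: mult_ac)
  moreover have "?q * r ^ 3 = r"
    using r(2) by (metis mult.assoc mult_1 power2_eq_square power3_eq_cube)
  ultimately have "?S * (2/3 * r) \<le> ?q"
    by simp
  hence "?S * (2/3) \<le> ?q * sqrt ?q"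
    using Q_x0_pos by (simp add: r_def field_simps)
  thus ?thesis
    by (simp add: mult_ac)
qed

end

subsection \<open>The virial inequality\<close>

context jacobi_max
begin

definition h2 :: real where "h2 = jacobi_h2 k a b"

lemma h2_pos: "h2 > 0"
  unfolding h2_def using a b by (intro jacobi_h2_pos) auto

text \<open>The partial integral of u^2 d\<theta>, since dx = -sin \<theta> d\<theta>.\<close>

definition mass :: "real \<Rightarrow> real" where
  "mass x = integral {-1..x} (\<lambda>x. w x * (P x)\<^sup>2)"

lemma mass_bounds: "mass (-1) = 0" "mass x0 \<le> h2"
proof -
  have int: "((\<lambda>x. w x * (P x)\<^sup>2) has_integral h2) {-1..1}"
    unfolding P_def h2_def using a b by (intro has_integral_jacobiP_squared) auto
  have sub: "{-1..x0} \<subseteq> {-1..1}"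
    using x0 by auto
  have I: "(\<lambda>x. w x * (P x)\<^sup>2) integrable_on {-1..1}"
    using int by (rule has_integral_integrable)
  have "mass x0 \<le> integral {-1..1} (\<lambda>x. w x * (P x)\<^sup>2)"
    unfolding mass_def
    by (rule integral_subset_le[OF sub integrable_on_subinterval[OF I sub] I]) simp
  thus "mass x0 \<le> h2"
    using int by (simp add: integral_unique)
qed (simp add: mass_def)

lemma continuous_density: "continuous_on {-1..1} (\<lambda>x. w x * (P x)\<^sup>2)"
  by (intro continuous_intros) auto

lemma deriv_mass:
  assumes "\<bar>x\<bar> < 1"
  shows "(mass has_real_derivative w x * (P x)\<^sup>2) (at x)"
proof -
  have "(mass has_real_derivative w x * (P x)\<^sup>2) (at x within {-1..1})"
    unfolding mass_def using assms continuous_density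
    by (intro integral_has_real_derivative) auto
  moreover have "at x within {-1..1} = at x"
    using assms by (intro at_within_interior) auto
  ultimately show ?thesis
    by simp
qed

lemma continuous_mass: "continuous_on {-1..1} mass"
  unfolding mass_def
  by (intro indefinite_integral_continuous_1 integrable_continuous_interval continuous_density)

definition \<delta> :: real where "\<delta> = ctr + rad"

lemma delta: "\<delta> < 1" "x0 < \<delta>" "-1 < \<delta>"
proof -
  show "\<delta> < 1"
    using ctr_plus_rad by (simp add: \<delta>_def)
  have "(x0 - ctr)\<^sup>2 < rad\<^sup>2"
    using Z_x0_pos N_pos by (simp add: Z_eq zero_less_mult_iff)
  hence "x0 - ctr < rad"
    by (rule power2_less_imp_less) (use rad_pos in auto)
  thus "x0 < \<delta>"
    by (simp add: \<delta>_def)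
  thus "-1 < \<delta>"
    using x0 by auto
qed

text \<open>The choice \<open>\<psi> = (\<delta> - x)\<^bsup>-1/2\<^esup> - \<kappa>\<close> makes the main term \<open>2 \<psi>' Z + \<psi> Z'\<close> of the virial
  identity bounded while \<open>\<psi> Z\<close> is of order \<open>sqrt Z\<close> near the turning point \<open>\<delta>\<close>. The remaining
  third-order term is negative up to a small error, and there \<open>F \<le> F x0\<close> is enough.\<close>

lemma virial_bound:
  "F x0 * (Z x0 / s0 * (1 / sqrt (\<delta> - x0) - 1 / (4 * sqrt rad)) - sqrt 2 / 8) \<le>
     (N\<^sup>2 * sqrt rad + 1 / (8 * sqrt rad)) * h2"
proof -
  let ?M = "F x0"
  \<comment> \<open>The main term is N^2 times v - 2 \<kappa> (v^2 - rad), with maximum 1/(8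
    \<kappa>) + 2 \<kappa> rad over v. This \<kappa> minimizes that maximum, with value
    \<open>sqrt rad\<close>.\<close>
  define \<kappa> where "\<kappa> = 1 / (4 * sqrt rad)"
  define C where "C = N\<^sup>2 * sqrt rad + \<kappa> / 2"
  define v where "v = (\<lambda>x. sqrt (\<delta> - x))"
  define \<Delta> where "\<Delta> = 1 - \<delta>\<^sup>2"
  define \<psi> where "\<psi> = (\<lambda>x. 1 / v x - \<kappa>)"
  define \<psi>' where "\<psi>' = (\<lambda>x. 1 / (2 * v x ^ 3))"
  define \<phi> where "\<phi> = (\<lambda>x. x * \<psi> x - (1 - x\<^sup>2) * \<psi>' x)"
  \<comment> \<open>The derivative of \<open>\<phi>\<close> without its constant -\<kappa>. The
    function \<open>sqrt (1 - x\<^sup>2) * \<rho>1 x\<close> has derivative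
    \<open>Y x / sqrt (1 - x\<^sup>2)\<close>, which matches the third-order term.\<close>
  define \<rho>1 where "\<rho>1 = (\<lambda>x. 1 / (4 * v x) - 3 * \<Delta> / (4 * v x ^ 5))"
  define \<rho> where "\<rho> = (\<lambda>x. \<rho>1 x - \<kappa>)"
  define \<rho>' where "\<rho>' = (\<lambda>x. 1 / (8 * v x ^ 3) - 15 * \<Delta> / (8 * v x ^ 7))"
  define Y where "Y = (\<lambda>x. (1 - x\<^sup>2) * \<rho>' x - x * \<rho>1 x)"
  define J where "J = (\<lambda>x. w x * (\<psi> x * (R x * R x) + \<phi> x * (P x * R x) +
                    (Z x * \<psi> x - (1 - x\<^sup>2) * \<rho> x / 2) * (P x * P x)))"
  \<comment> \<open>The \<open>\<rho>1\<close> term turns the third-order contribution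
    \<open>- Y x * F x\<close> into \<open>Y x * (?M - F x)\<close>, harmless where
    \<open>Y x \<le> 0\<close>. Where \<open>Y x\<close> is positive, the term in
    \<open>sqrt (1 + x)\<close> compensates.\<close>
  define H where "H = (\<lambda>x. J x + ?M / 2 * (sqrt (1 - x\<^sup>2) * \<rho>1 x - sqrt (1 + x) / 4) - C * mass x)"
  have \<kappa>: "\<kappa> > 0"
    using rad_pos by (simp add: \<kappa>_def)
  have v: "v x > 0" "x = \<delta> - (v x)\<^sup>2" if "x \<le> x0" for x
    using that delta by (auto simp: v_def)
  have \<Delta>: "\<Delta> = (1 - \<delta>) * (1 + \<delta>)" "\<Delta> > 0"
    using delta by (auto simp: \<Delta>_def power2_eq_square algebra_simps abs_square_less_1 [unfolded power2_eq_square])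
  have deriv_v: "(v has_real_derivative - 1 / (2 * v x)) (at x)" if "x \<le> x0" for x
    unfolding v_def using v(1)[OF that, unfolded v_def]
    by (auto intro!: derivative_eq_intros simp: field_simps)
  have deriv_\<psi>: "(\<psi> has_real_derivative \<psi>' x) (at x)" if "x \<le> x0" for x
    unfolding \<psi>_def \<psi>'_def using v(1)[OF that]
    by (auto intro!: derivative_eq_intros deriv_v that simp: field_simps power2_eq_square power3_eq_cube)
  have deriv_\<phi>: "(\<phi> has_real_derivative \<rho> x) (at x)" if "x \<le> x0" for x
  proof -
    have "(\<psi>' has_real_derivative 3 / (4 * v x ^ 5)) (at x)"
      unfolding \<psi>'_def using v(1)[OF that]
      by (auto intro!: derivative_eq_intros deriv_v that simp: field_simps eval_nat_numeral)
    hence "(\<phi> has_real_derivative \<psi> x + x * \<psi>' x - ((1 - x\<^sup>2) * (3 / (4 * v x ^ 5)) - 2 * x * \<psi>' x)) (at x)"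
      unfolding \<phi>_def by (auto intro!: derivative_eq_intros deriv_\<psi> that)
    also have "\<psi> x + x * \<psi>' x - ((1 - x\<^sup>2) * (3 / (4 * v x ^ 5)) - 2 * x * \<psi>' x) = \<rho> x"
    proof -
      have "1 / u - \<kappa> + t * (1 / (2 * u ^ 3)) - ((1 - t\<^sup>2) * (3 / (4 * u ^ 5)) - 2 * t * (1 / (2 * u ^ 3)))
        = 1 / (4 * u) - 3 * (1 - \<delta>\<^sup>2) / (4 * u ^ 5) - \<kappa>" if "u > 0" "t = \<delta> - u\<^sup>2" for u t
        unfolding that(2) using that(1) by (simp add: field_simps eval_nat_numeral)
      from this[OF v[OF that]] show ?thesis
        unfolding \<psi>_def \<psi>'_def \<rho>_def \<rho>1_def \<Delta>_def .
    qed
    finally show ?thesis .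
  qed
  have deriv_\<rho>1: "(\<rho>1 has_real_derivative \<rho>' x) (at x)" if "x \<le> x0" for x
    unfolding \<rho>1_def \<rho>'_def using v(1)[OF that]
    by (auto intro!: derivative_eq_intros deriv_v that simp: field_simps eval_nat_numeral)
  hence deriv_\<rho>: "(\<rho> has_real_derivative \<rho>' x) (at x)" if "x \<le> x0" for x
    unfolding \<rho>_def using that by (auto intro!: derivative_eq_intros)
  have Y_le: "Y x \<le> v x / 8" if "x \<le> x0" "-1 < x" for x
  proof -
    define u where "u = v x"
    define e where "e = u\<^sup>2"
    have u: "u > 0" "x = \<delta> - u\<^sup>2"
      using v[OF that(1)] by (auto simp: u_def)
    have e: "e > 0" "e < 1 + \<delta>"
      using u that by (auto simp: e_def)
    \<comment> \<open>Here \<open>e < 1 + \<delta>\<close> is the condition x > -1; inserting this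
      bound into the bracket gives \<open>10 - 14 * \<delta>\<close>.\<close>
    have "e * (10 * e - 24 * \<delta>) \<le> 15 * \<Delta>"
    proof (cases "10 - 14 * \<delta> \<le> 0")
      case True
      hence "e * (10 * e - 24 * \<delta>) \<le> 0"
        using e by (intro mult_nonneg_nonpos) auto
      thus ?thesis using \<Delta>(2) by linarith
    next
      case False
      have "e * (10 * e - 24 * \<delta>) \<le> e * (10 - 14 * \<delta>)"
        using e by (intro mult_left_mono) auto
      also have "\<dots> \<le> (1 + \<delta>) * (10 - 14 * \<delta>)"
        using e False by (intro mult_right_mono) auto
      also have "\<dots> \<le> (1 + \<delta>) * (15 - 15 * \<delta>)"
        using delta by (intro mult_left_mono) auto
      finally show ?thesis
        by (simp add: \<Delta>(1) algebra_simps)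
    qed
    hence "\<Delta> * (10 * e\<^sup>2 - 24 * \<delta> * e - 15 * \<Delta>) \<le> 0"
      using \<Delta>(2) by (intro mult_nonneg_nonpos) (auto simp: power2_eq_square algebra_simps)
    moreover have "8 * u ^ 7 * Y x = e ^ 4 + \<Delta> * (10 * e\<^sup>2 - 24 * \<delta> * e - 15 * \<Delta>)"
    proof -
      have "8 * u ^ 7 * Y x = (1 - x\<^sup>2) * (u ^ 4 - 15 * \<Delta>) - x * (2 * u ^ 6 - 6 * \<Delta> * u\<^sup>2)"
        using u(1) unfolding Y_def \<rho>'_def \<rho>1_def u_def [symmetric]
        by (simp add: field_simps eval_nat_numeral)
      also have "1 - x\<^sup>2 = \<Delta> + 2 * \<delta> * u\<^sup>2 - u ^ 4"
        unfolding u(2) \<Delta>_def by (simp add: field_simps eval_nat_numeral)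
      also have "(\<Delta> + 2 * \<delta> * u\<^sup>2 - u ^ 4) * (u ^ 4 - 15 * \<Delta>) - x * (2 * u ^ 6 - 6 * \<Delta> * u\<^sup>2) =
         e ^ 4 + \<Delta> * (10 * e\<^sup>2 - 24 * \<delta> * e - 15 * \<Delta>)"
        unfolding u(2) e_def by (simp add: field_simps eval_nat_numeral)
      finally show ?thesis .
    qed
    ultimately have "8 * u ^ 7 * Y x \<le> 8 * u ^ 7 * (u / 8)"
      by (simp add: e_def eval_nat_numeral)
    thus ?thesis
      using u(1) by (simp add: u_def [symmetric] mult_le_cancel_left_pos)
  qed
  have "H x0 \<le> H (-1)"
  proof (rule DERIV_nonpos_imp_decreasing_open[where f = H])
    show "-1 \<le> x0"
      using x0 by auto
    have cont_v: "continuous_on {-1..x0} v"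
      unfolding v_def by (intro continuous_intros)
    have "\<forall>x\<in>{-1..x0}. v x \<noteq> 0"
      using v(1) by force
    thus "continuous_on {-1..x0} H"
      unfolding H_def J_def \<phi>_def \<psi>_def \<psi>'_def \<rho>_def \<rho>1_def using x0
      by (intro continuous_intros cont_v continuous_on_subset[OF continuous_mass]) auto
    fix x assume x: "-1 < x" "x < x0"
    hence x1: "\<bar>x\<bar> < 1" and xle: "x \<le> x0"
      using x0 by auto
    define s where "s = sqrt (1 - x\<^sup>2)"
    have s: "s > 0" "s\<^sup>2 = 1 - x\<^sup>2"
      using pos_1_minus_sq[OF x1] by (simp_all add: s_def)
    let ?D = "w x * (P x)\<^sup>2"
    have D: "s * ?D = F x" "?D \<ge> 0"
      using F_eq[OF x1] by (simp_all add: s_def)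
    define J' where "J' = ?D * (2 * \<psi>' x * Z x + \<psi> x * Z' x + (x * \<rho> x - (1 - x\<^sup>2) * \<rho>' x) / 2)"
    define p where "p = sqrt (1 + x)"
    have p: "p > 0"
      using x by (simp add: p_def)
    have J': "(J has_real_derivative J') (at x)"
      unfolding J_def J'_def
      by (rule deriv_virial[OF x1 deriv_\<psi>[OF xle] deriv_\<phi>[OF xle] deriv_\<rho>[OF xle]]) (simp add: \<phi>_def)
    have "((\<lambda>x. sqrt (1 + x)) has_real_derivative 1 / (2 * p)) (at x)"
      using x unfolding p_def by (auto intro!: derivative_eq_intros simp: field_simps)
    hence "(H has_real_derivative J' + ?M / 2 * ((- x / s * \<rho>1 x + \<rho>' x * s) - 1 / (2 * p) / 4) - C * ?D) (at x)"
      unfolding H_def s_def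
      by (intro DERIV_add DERIV_diff DERIV_cmult DERIV_mult DERIV_cdivide J' deriv_mass[OF x1]
            deriv_sqrt[OF x1] deriv_\<rho>1[OF xle])
    moreover have "J' + ?M / 2 * ((- x / s * \<rho>1 x + \<rho>' x * s) - 1 / (2 * p) / 4) - C * ?D \<le> 0"
    proof -
      have main: "2 * \<psi>' x * Z x + \<psi> x * Z' x + (x * \<rho> x - (1 - x\<^sup>2) * \<rho>' x) / 2 =
         N\<^sup>2 * v x - 2 * \<kappa> * N\<^sup>2 * ((v x)\<^sup>2 - rad) - \<kappa> * x / 2 - Y x / 2"
      proof -
        have ct: "ctr - x = (v x)\<^sup>2 - rad" "x - ctr = rad - (v x)\<^sup>2"
          using v[OF xle] unfolding \<delta>_def by auto
        have Zx: "Z x = N\<^sup>2 * (v x)\<^sup>2 * (2 * rad - (v x)\<^sup>2)"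
          unfolding Z_eq ct by (simp add: power2_eq_square algebra_simps)
        show ?thesis
          using v(1)[OF xle] unfolding Zx Z'_eq ct \<psi>'_def \<psi>_def Y_def \<rho>_def
          by (simp add: field_simps power2_eq_square power3_eq_cube)
      qed
      \<comment> \<open>This is where the choice of \<kappa> pays off: the arithmetic-geometric mean
        inequality is the bound by \<open>sqrt rad\<close>, valid for every v.\<close>
      have "sqrt rad * (v x) \<le> ((v x)\<^sup>2 + rad) / 2"
        using sum_squares_bound[of "sqrt rad" "v x"] rad_pos by (simp add: power2_eq_square)
      hence "N\<^sup>2 * (v x - 2 * \<kappa> * ((v x)\<^sup>2 - rad)) \<le> N\<^sup>2 * sqrt rad"
        using rad_pos by (intro mult_left_mono) (auto simp: \<kappa>_def field_simps)
      moreover have "- \<kappa> * x / 2 \<le> \<kappa> / 2"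
        using mult_left_mono[of "- x" 1 \<kappa>] \<kappa> x by simp
      ultimately have "2 * \<psi>' x * Z x + \<psi> x * Z' x + (x * \<rho> x - (1 - x\<^sup>2) * \<rho>' x) / 2 \<le> C - Y x / 2"
        unfolding main C_def by (simp add: algebra_simps)
      hence "J' \<le> ?D * (C - Y x / 2)"
        unfolding J'_def using D by (intro mult_left_mono)
      moreover have "?D * Y x = Y x / s * F x"
        using s D by (simp add: field_simps)
      ultimately have J'_le: "J' \<le> C * ?D - Y x / s * F x / 2"
        by (simp add: algebra_simps)
      have h': "- x / s * \<rho>1 x + \<rho>' x * s = Y x / s"
        using s unfolding Y_def s(2) [symmetric] by (simp add: field_simps power2_eq_square)
      have "?M / 2 * (T - 1 / (2 * p) / 4) - T * F x / 2 = (T * (?M - F x) - ?M * (1 / (8 * p))) / 2" for T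
        by (simp add: field_simps)
      from this[of "Y x / s"] J'_le
      have "J' + ?M / 2 * ((- x / s * \<rho>1 x + \<rho>' x * s) - 1 / (2 * p) / 4) - C * ?D \<le>
         (Y x / s * (?M - F x) - ?M * (1 / (8 * p))) / 2"
        unfolding h' by linarith
      moreover have "Y x / s * (?M - F x) \<le> ?M * (1 / (8 * p))"
      proof (cases "Y x \<le> 0")
        case True
        hence "Y x / s * (?M - F x) \<le> 0"
          using s F_max[of x] x x0 by (intro mult_nonpos_nonneg divide_nonpos_pos) auto
        moreover have "0 \<le> ?M * (1 / (8 * p))"
          using p F_pos by simp
        ultimately show ?thesis by linarith
      next
        case False
        have s_eq: "s = sqrt (1 - x) * p"
          unfolding s_def p_def real_sqrt_mult [symmetric]
          by (simp add: power2_eq_square algebra_simps)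
        have "v x \<le> sqrt (1 - x)"
          unfolding v_def using delta by simp
        hence "Y x \<le> sqrt (1 - x) / 8"
          using Y_le[OF xle x(1)] by linarith
        hence "Y x / s \<le> sqrt (1 - x) / 8 / s"
          using s by (intro divide_right_mono) auto
        also have "\<dots> = 1 / (8 * p)"
          unfolding s_eq using x1 p by simp
        finally have "Y x / s \<le> 1 / (8 * p)" .
        hence "Y x / s * (?M - F x) \<le> 1 / (8 * p) * ?M"
          using False s F_max[of x] F_nonneg[of x] x x0 p by (intro mult_mono) auto
        thus ?thesis by (simp add: mult.commute)
      qed
      moreover have "X \<le> 0" if "X \<le> (A - B) / 2" "A \<le> B" for X A B :: real
        using that by simp
      ultimately show ?thesis
        by blast
    qed
    ultimately show "\<exists>d. (H has_real_derivative d) (at x) \<and> d \<le> 0"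
      by blast
  qed
  moreover have "H (-1) = 0"
    by (simp add: H_def J_def mass_bounds)
  moreover have "J x0 = ?M / s0 * (Z x0 * \<psi> x0 - s0\<^sup>2 * \<rho> x0 / 2)"
    using F_eq[OF x0] s0_pos pos_1_minus_sq[OF x0] by (simp add: J_def R_x0 power2_eq_square)
  \<comment> \<open>The part of the boundary term coming from \<open>\<rho>1\<close> cancels
    exactly, and the remainder with \<kappa> has the favourable sign.\<close>
  hence "J x0 + ?M / 2 * (s0 * \<rho>1 x0) = ?M * (Z x0 / s0 * \<psi> x0) + ?M / 2 * s0 * \<kappa>"
    using s0_pos by (simp add: \<rho>_def field_simps power2_eq_square)
  ultimately have "?M * (Z x0 / s0 * \<psi> x0) + ?M / 2 * s0 * \<kappa> - ?M / 8 * sqrt (1 + x0) \<le> C * mass x0"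
    by (simp add: H_def algebra_simps)
  moreover have "?M / 2 * s0 * \<kappa> \<ge> 0"
    using F_pos s0_pos \<kappa> by simp
  moreover have "?M / 8 * sqrt (1 + x0) \<le> ?M / 8 * sqrt 2"
    using F_pos x0 by (intro mult_left_mono real_sqrt_le_mono) auto
  moreover have "C * mass x0 \<le> C * h2"
    using mass_bounds \<kappa> rad_pos by (intro mult_left_mono) (auto simp: C_def)
  ultimately have "?M * (Z x0 / s0 * \<psi> x0) - ?M / 8 * sqrt 2 \<le> C * h2"
    by linarith
  thus ?thesis
    by (simp add: \<psi>_def v_def C_def \<kappa>_def algebra_simps)
qed

end

subsection \<open>The size of \<open>q = Q(x0) / N\<^sup>2\<close>\<close>

text \<open>Here m is \<open>max a b\<close>, r is \<open>rad\<close>, s is \<open>s0\<close> and y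
  is \<open>x0 - ctr\<close>. If q were too small, y would be comparable to r, and
  \<open>main\<close> would bound r^2 from above by a multiple of s^2. The geometric bounds
  \<open>r1\<close> and \<open>r2\<close> give contradictory lower bounds.\<close>

lemma turning_point_arith:
  fixes k m N r s y q :: real
  assumes k: "k \<ge> 6" and m: "m \<ge> 6035/10000" and N: "N > 0" "N \<le> k + m + 1/2"
    and pos: "q > 0" "s > 0" "y \<ge> 0" "r > 0"
    and y: "q * s\<^sup>2 = r\<^sup>2 - y\<^sup>2"
    and main: "N * (q * sqrt q) * s \<ge> 4/3 * (y - q)"
    and r1: "k * s\<^sup>2 \<le> 2 * r\<^sup>2 * (k + m)"
    and r2: "(1 - q) * k\<^sup>2 * s\<^sup>2 \<le> r\<^sup>2 * m\<^sup>2"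
    and r3: "k \<le> r * (k + m)"
  shows "k < q ^ 3 * (100 * m\<^sup>2 * (k + m))"
proof (rule ccontr)
  assume "\<not> ?thesis"
  hence le: "q ^ 3 * (100 * m\<^sup>2 * (k + m)) \<le> k"
    by simp
  have km: "k + m > 0" "m > 0" "k > 0"
    using k m by auto
  \<comment> \<open>The constants fit because 1.83^2 < 100 * 0.325^3, while k + m \<le> 1.83 k m is
    nearly an equality at the corner k = 6, m = 0.6035.\<close>
  have q: "q * (k + m) \<le> 325/1000 * k"
  proof (rule ccontr)
    assume "\<not> ?thesis"
    hence "(325/1000 * k) ^ 3 < (q * (k + m)) ^ 3"
      using km by (intro power_strict_mono) auto
    hence "(325/1000 * k) ^ 3 * (100 * m\<^sup>2) < (q * (k + m)) ^ 3 * (100 * m\<^sup>2)"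
      using km by (intro mult_strict_right_mono) auto
    also have "\<dots> = q ^ 3 * (100 * m\<^sup>2 * (k + m)) * (k + m)\<^sup>2"
      by (simp add: power2_eq_square power3_eq_cube)
    also have "\<dots> \<le> k * (k + m)\<^sup>2"
      using le by (intro mult_right_mono) auto
    finally have "k * (100 * (325/1000) ^ 3 * (k * m)\<^sup>2) < k * (k + m)\<^sup>2"
      by (simp add: power2_eq_square power3_eq_cube mult_ac)
    hence less: "100 * (325/1000) ^ 3 * (k * m)\<^sup>2 < (k + m)\<^sup>2"
      using km by (simp add: mult_less_cancel_left_pos)
    have "0 \<le> (k - 6) * (183/100 * m - 1) + (998/100 * m - 6)"
      using k m by (intro add_nonneg_nonneg mult_nonneg_nonneg) auto
    hence "k + m \<le> 183/100 * (k * m)"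
      by (simp add: field_simps)
    hence "(k + m)\<^sup>2 \<le> (183/100 * (k * m))\<^sup>2"
      using km by (intro power_mono) auto
    also have "\<dots> = (183/100)\<^sup>2 * (k * m)\<^sup>2"
      by (simp only: power_mult_distrib)
    also have "\<dots> \<le> 100 * (325/1000) ^ 3 * (k * m)\<^sup>2"
      by (intro mult_right_mono) (auto simp: power2_eq_square power3_eq_cube)
    finally show False
      using less by simp
  qed
  have "q * (k + m) \<le> (325/1000 * r) * (k + m)"
    using q r3 by simp
  hence q_r: "q \<le> 325/1000 * r"
    using km by simp
  have "q * (k + m) \<le> 325/1000 * (k + m)"
    using q km by simp
  hence q_1: "q \<le> 325/1000"
    by (rule mult_right_le_imp_le) (use km in auto)
  have "(q * s\<^sup>2) * (k + m) \<le> (325/1000 * k) * s\<^sup>2"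
    using mult_right_mono[OF q, of "s\<^sup>2"] by (simp add: mult_ac)
  also have "\<dots> \<le> (65/100 * r\<^sup>2) * (k + m)"
    using r1 by (simp add: mult_ac)
  finally have "q * s\<^sup>2 \<le> 65/100 * r\<^sup>2"
    using km by simp
  moreover have "(59/100 * r)\<^sup>2 = 3481/10000 * r\<^sup>2" "0 \<le> r\<^sup>2"
    by (simp_all add: power2_eq_square)
  \<comment> \<open>The remaining share 0.35 of r^2 exceeds 0.59^2 = 0.3481; subtracting q \<le>
    0.325 r from y then leaves 0.265 r.\<close>
  ultimately have "(59/100 * r)\<^sup>2 \<le> y\<^sup>2"
    using y by linarith
  hence "59/100 * r \<le> y"
    by (rule power2_le_imp_le) (use pos in auto)
  hence "265/1000 * r \<le> y - q"
    using q_r by simp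
  hence "4/3 * (265/1000 * r) \<le> 4/3 * (y - q)"
    by simp
  also note main
  finally have "4/3 * (265/1000 * r) \<le> N * (q * sqrt q) * s" .
  hence "(4/3 * (265/1000 * r))\<^sup>2 \<le> (N * (q * sqrt q) * s)\<^sup>2"
    using pos by (intro power_mono) auto
  also have "\<dots> = N\<^sup>2 * q ^ 3 * s\<^sup>2"
    using pos by (simp add: power_mult_distrib power2_eq_square power3_eq_cube)
  finally have "(4/3 * (265/1000 * r))\<^sup>2 \<le> N\<^sup>2 * q ^ 3 * s\<^sup>2" .
  moreover have "(4/3 * (265/1000 * r))\<^sup>2 = 2809/22500 * r\<^sup>2" "0 \<le> r\<^sup>2"
    by (simp_all add: power2_eq_square)
  ultimately have "124/1000 * r\<^sup>2 \<le> N\<^sup>2 * q ^ 3 * s\<^sup>2"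
    by linarith
  hence "124/1000 * r\<^sup>2 * (100 * m\<^sup>2 * (k + m)) \<le> N\<^sup>2 * q ^ 3 * s\<^sup>2 * (100 * m\<^sup>2 * (k + m))"
    using km by (intro mult_right_mono) auto
  also have "\<dots> = N\<^sup>2 * s\<^sup>2 * (q ^ 3 * (100 * m\<^sup>2 * (k + m)))"
    by simp
  also have "\<dots> \<le> N\<^sup>2 * s\<^sup>2 * k"
    using le by (intro mult_left_mono) auto
  \<comment> \<open>The excess 1/2 of N over k + m costs a factor 1.16, because k + m > 6.6.\<close>
  also have "\<dots> \<le> 116/100 * (k + m)\<^sup>2 * s\<^sup>2 * k"
  proof -
    have "N\<^sup>2 \<le> (k + m + 1/2)\<^sup>2"
      using N by (intro power_mono) auto
    also have "\<dots> = (k + m)\<^sup>2 + (k + m) + 1/4"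
      by (simp add: power2_eq_square algebra_simps)
    also have "\<dots> \<le> 116/100 * (k + m)\<^sup>2"
    proof -
      have "66/10 * (k + m) \<le> (k + m)\<^sup>2"
        unfolding power2_eq_square using k m by (intro mult_right_mono) auto
      moreover have "X + t + 1/4 \<le> 116/100 * X" if "66/10 * t \<le> X" "66/10 \<le> t" for X t :: real
        using that by linarith
      ultimately show ?thesis
        using k m by simp
    qed
    finally show ?thesis
      using km by (intro mult_right_mono) auto
  qed
  also have "\<dots> = 116/100 * ((k + m) * s\<^sup>2 * k) * (k + m)"
    by (simp add: power2_eq_square)
  also have "124/1000 * r\<^sup>2 * (100 * m\<^sup>2 * (k + m)) = 124/10 * (r\<^sup>2 * m\<^sup>2) * (k + m)"
    by simp
  finally have "124/10 * (r\<^sup>2 * m\<^sup>2) * (k + m) \<le> 116/100 * ((k + m) * s\<^sup>2 * k) * (k + m)" .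
  hence fin: "124/10 * (r\<^sup>2 * m\<^sup>2) \<le> 116/100 * ((k + m) * s\<^sup>2 * k)"
    by (rule mult_right_le_imp_le) (use km in auto)
  show False
  \<comment> \<open>For k \<le> m, \<open>r1\<close> makes 6.2 compete with 1.16 * 4 = 4.64. For k >
    m, \<open>r2\<close> with 1 - q \<ge> 0.675 makes 8.37 compete with 1.16 * 2 = 2.32.\<close>
  proof (cases "k \<le> m")
    case True
    have "62/10 * (k * s\<^sup>2) * m\<^sup>2 \<le> 62/10 * (2 * r\<^sup>2 * (k + m)) * m\<^sup>2"
      using r1 by (intro mult_right_mono mult_left_mono) auto
    also have "\<dots> = 124/10 * (r\<^sup>2 * m\<^sup>2) * (k + m)"
      by simp
    also have "\<dots> \<le> 116/100 * ((k + m) * s\<^sup>2 * k) * (k + m)"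
      using fin km by (intro mult_right_mono) auto
    also have "\<dots> = 116/100 * (k * s\<^sup>2) * (k + m)\<^sup>2"
      by (simp add: power2_eq_square)
    also have "\<dots> \<le> 116/100 * (k * s\<^sup>2) * (2 * m)\<^sup>2"
      using True km by (intro mult_left_mono power_mono) auto
    finally have "(k * s\<^sup>2 * m\<^sup>2) * (62/10 - 464/100) \<le> 0"
      by (simp add: power_mult_distrib)
    moreover have "0 < (k * s\<^sup>2 * m\<^sup>2) * (62/10 - 464/100)"
      using km pos by (intro mult_pos_pos) auto
    ultimately show False
      by (meson not_le)
  next
    case False
    have "675/1000 * (k\<^sup>2 * s\<^sup>2) \<le> (1 - q) * (k\<^sup>2 * s\<^sup>2)"
      using q_1 by (intro mult_right_mono) auto
    also have "\<dots> = (1 - q) * k\<^sup>2 * s\<^sup>2"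
      by simp
    also note r2
    finally have "124/10 * (675/1000 * (k\<^sup>2 * s\<^sup>2)) \<le> 124/10 * (r\<^sup>2 * m\<^sup>2)"
      by (simp add: mult_ac)
    also note fin
    also have "116/100 * ((k + m) * s\<^sup>2 * k) \<le> 116/100 * ((2 * k) * s\<^sup>2 * k)"
      using False km by (intro mult_left_mono mult_right_mono) auto
    also have "\<dots> = 232/100 * (k\<^sup>2 * s\<^sup>2)"
      by (simp add: power2_eq_square)
    finally have "(k\<^sup>2 * s\<^sup>2) * (837/100 - 232/100) \<le> 0"
      by (simp add: algebra_simps)
    moreover have "0 < (k\<^sup>2 * s\<^sup>2) * (837/100 - 232/100)"
      using km pos by (intro mult_pos_pos) auto
    ultimately show False
      by (meson not_le)
  qed
qed

section \<open>Half-width of the oscillatory interval\<close>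

context jacobi
begin

text \<open>In the product defining \<open>rad\<close>, the factors \<open>K + 2 * max a b\<close>
  and \<open>K + 2 * a + 2 * b\<close> together dominate \<open>(2 * N)\<^sup>2\<close>; the two
  other factors remain.\<close>

lemma N2_rad2_ge: "K * (K + 2 * min a b) / 4 \<le> N\<^sup>2 * rad\<^sup>2"
proof -
  let ?l = "min a b" and ?m = "max a b"
  have lm: "(K + 2 * a) * (K + 2 * b) = (K + 2 * ?l) * (K + 2 * ?m)"
    by (simp add: min_def max_def)
  have "2 * N * (2 * N) \<le> (K + 2 * ?m) * (K + 2 * a + 2 * b)"
    unfolding N_eq using a b K_ge by (intro mult_mono) auto
  hence "K * (K + 2 * ?l) * (4 * N\<^sup>2) \<le> K * (K + 2 * ?l) * ((K + 2 * ?m) * (K + 2 * a + 2 * b))"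
    using a b K_ge by (intro mult_left_mono) (auto simp: power2_eq_square)
  also have "\<dots> = K * (K + 2 * a) * (K + 2 * b) * (K + 2 * a + 2 * b)"
    using lm by (simp add: mult_ac)
  also have "\<dots> = N\<^sup>2 * rad\<^sup>2 * (16 * N\<^sup>2) - 4 * N\<^sup>2"
    unfolding rad_sq using N_pos by (simp add: field_simps power2_eq_square power4_eq_xxxx)
  finally have "(K * (K + 2 * ?l) / 4) * (16 * N\<^sup>2) \<le> N\<^sup>2 * rad\<^sup>2 * (16 * N\<^sup>2)"
    by (simp add: field_simps) (use zero_le_power2[of N] in linarith)
  thus ?thesis
    by (rule mult_right_le_imp_le) (use N_pos in simp)
qed

lemma rad_less_1: "rad < 1"
  using ctr_plus_rad ctr_minus_rad by linarith

lemma N_rad_ge: "K / 2 \<le> N * rad"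
proof -
  have "0 \<le> K * min a b"
    using a b K_ge by simp
  hence "(K / 2)\<^sup>2 \<le> (N * rad)\<^sup>2"
    using N2_rad2_ge by (simp add: power_mult_distrib power2_eq_square algebra_simps)
  thus ?thesis
    by (rule power2_le_imp_le) (use N_pos rad_pos in auto)
qed

lemma N_le: "N \<le> real k + max a b + 1/2"
  by (simp add: N_def)

lemma k_le_rad: "real k \<le> rad * (real k + max a b)"
proof -
  let ?m = "max a b"
  have "K / 2 \<le> N * rad"
    by (rule N_rad_ge)
  also have "\<dots> \<le> (K / 2 + ?m) * rad"
    using N_le rad_pos by (intro mult_right_mono) (auto simp: K_def add_divide_distrib)
  finally have "K * (1 - rad) \<le> 2 * ?m * rad"
    by (simp add: algebra_simps)
  moreover have "2 * real k * (1 - rad) \<le> K * (1 - rad)"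
    using rad_less_1 by (intro mult_right_mono) (auto simp: K_def)
  ultimately show ?thesis
    by (simp add: algebra_simps)
qed

end

context jacobi_max
begin

lemma y_le_rad: "x0 - ctr < rad"
  using delta(2) by (simp add: \<delta>_def)

lemma s0_sq: "s0\<^sup>2 = 1 - x0\<^sup>2"
  using pos_1_minus_sq[OF x0] by simp

text \<open>\<open>x0 \<ge> ctr\<close> bounds \<open>1 - x0\<close>. The left turning point lies
  above -1, so \<open>rad < 1 + ctr\<close>, and \<open>x0 < ctr + rad\<close> bounds
  \<open>1 + x0\<close> by twice \<open>1 + ctr\<close>.\<close>

lemma s0_sq_le: "s0\<^sup>2 \<le> 2 * ((1 - ctr) * (1 + ctr))"
proof -
  have "1 - x0\<^sup>2 = (1 - x0) * (1 + x0)"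
    by (simp add: power2_eq_square algebra_simps)
  also have "\<dots> \<le> (1 - ctr) * (2 * (1 + ctr))"
    using x0 x0_ge y_le_rad ctr_minus_rad ctr_bounds by (intro mult_mono) auto
  also have "\<dots> = 2 * ((1 - ctr) * (1 + ctr))"
    by simp
  finally show ?thesis
    by (simp add: s0_sq)
qed

text \<open>Both factors in \<open>s0_sq_le\<close> are known from the values of \<open>Z\<close> at
  the endpoints, so their squares multiply to an expression symmetric in a and b. Of the two
  inequalities 1 and 2, the factor \<open>K + 2 * min a b\<close> cancels in the product.\<close>

lemma rad_s0_bound1: "real k * s0\<^sup>2 \<le> 2 * rad\<^sup>2 * (real k + max a b)"
proof -
  let ?l = "min a b" and ?m = "max a b"
  define \<rho> where "\<rho> = N\<^sup>2 * rad\<^sup>2"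
  have l: "?l > 0" "?l \<le> ?m" "K > 0"
    using a b K_ge by auto
  have \<rho>: "K * (K + 2 * ?l) / 4 \<le> \<rho>" "\<rho> > 0"
    using N2_rad2_ge N_pos rad_pos by (simp_all add: \<rho>_def)
  have "K * (K + 2 * ?l) / 4 = K * K / 4 + K * ?l / 2"
    by (simp add: field_simps)
  hence "K * ?l \<le> 2 * \<rho>"
    using \<rho>(1) zero_le_square[of K] by linarith
  hence "?l * (K * ?l) \<le> ?l * (2 * \<rho>)"
    using l by (intro mult_left_mono) auto
  hence 1: "K * (\<rho> + ?l\<^sup>2) \<le> \<rho> * (K + 2 * ?l)"
    by (simp add: power2_eq_square algebra_simps)
  have 2: "K * (\<rho> + ?m\<^sup>2) * (K + 2 * ?l) \<le> \<rho> * (K + 2 * ?m)\<^sup>2"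
  proof -
    have "K * (K + 2 * ?l) * ?m\<^sup>2 \<le> 4 * \<rho> * ?m\<^sup>2"
      using \<rho>(1) by (intro mult_right_mono) auto
    moreover have "K * ?l \<le> K * ?m"
      using l by (intro mult_left_mono) auto
    hence "\<rho> * (K * (K + 2 * ?l)) \<le> \<rho> * (K * (K + 4 * ?m))"
      using \<rho>(2) l by (intro mult_left_mono) auto
    ultimately show ?thesis
      by (simp add: power2_eq_square algebra_simps)
  qed
  have "K * (\<rho> + ?l\<^sup>2) * (K * (\<rho> + ?m\<^sup>2) * (K + 2 * ?l)) \<le>
        \<rho> * (K + 2 * ?l) * (\<rho> * (K + 2 * ?m)\<^sup>2)"
    using \<rho>(2) l by (intro mult_mono 1 2) auto
  hence "(K\<^sup>2 * ((\<rho> + ?l\<^sup>2) * (\<rho> + ?m\<^sup>2))) * (K + 2 * ?l) \<le> (\<rho> * (K + 2 * ?m))\<^sup>2 * (K + 2 * ?l)"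
    by (simp add: power2_eq_square mult_ac)
  hence 3: "K\<^sup>2 * ((\<rho> + ?l\<^sup>2) * (\<rho> + ?m\<^sup>2)) \<le> (\<rho> * (K + 2 * ?m))\<^sup>2"
    by (rule mult_right_le_imp_le) (use l in auto)
  have AB: "N\<^sup>2 * (1 - ctr)\<^sup>2 = \<rho> + (a\<^sup>2 - 1/4)" "N\<^sup>2 * (1 + ctr)\<^sup>2 = \<rho> + (b\<^sup>2 - 1/4)"
    unfolding rad_sq_right [symmetric] rad_sq_left [symmetric] \<rho>_def
    using N_pos by (simp_all add: field_simps)
  have "(K * (N\<^sup>2 * s0\<^sup>2))\<^sup>2 \<le> (K * (N\<^sup>2 * (2 * ((1 - ctr) * (1 + ctr)))))\<^sup>2"
    using s0_sq_le l by (intro power_mono mult_left_mono) auto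
  also have "\<dots> = 4 * (K\<^sup>2 * ((N\<^sup>2 * (1 - ctr)\<^sup>2) * (N\<^sup>2 * (1 + ctr)\<^sup>2)))"
    by (simp add: power_mult_distrib power2_eq_square)
  also have "\<dots> \<le> 4 * (K\<^sup>2 * ((\<rho> + a\<^sup>2) * (\<rho> + b\<^sup>2)))"
    unfolding AB using \<rho>(2) A_pos B_pos by (intro mult_left_mono mult_mono) auto
  also have "(\<rho> + a\<^sup>2) * (\<rho> + b\<^sup>2) = (\<rho> + ?l\<^sup>2) * (\<rho> + ?m\<^sup>2)"
    by (simp add: min_def max_def)
  also have "4 * (K\<^sup>2 * \<dots>) \<le> 4 * (\<rho> * (K + 2 * ?m))\<^sup>2"
    using 3 by simp
  also have "\<dots> = (2 * (\<rho> * (K + 2 * ?m)))\<^sup>2"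
    by (simp add: power_mult_distrib)
  finally have "K * (N\<^sup>2 * s0\<^sup>2) \<le> 2 * (\<rho> * (K + 2 * ?m))"
    by (rule power2_le_imp_le) (use \<rho> l in auto)
  hence "N\<^sup>2 * (K * s0\<^sup>2) \<le> N\<^sup>2 * (2 * rad\<^sup>2 * (K + 2 * ?m))"
    by (simp add: \<rho>_def mult_ac)
  hence "K * s0\<^sup>2 \<le> 2 * rad\<^sup>2 * (K + 2 * ?m)"
    using N_pos by simp
  hence "real k * (K * s0\<^sup>2) \<le> real k * (2 * rad\<^sup>2 * (K + 2 * ?m))"
    by (intro mult_left_mono) auto
  also have "\<dots> = 2 * rad\<^sup>2 * (real k * (K + 2 * ?m))"
    by simp
  also have "\<dots> \<le> 2 * rad\<^sup>2 * (K * (real k + ?m))"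
    using l by (intro mult_left_mono) (auto simp: K_def algebra_simps)
  finally have "K * (real k * s0\<^sup>2) \<le> K * (2 * rad\<^sup>2 * (real k + ?m))"
    by (simp add: mult_ac)
  thus ?thesis
    using l by simp
qed

definition q :: real where "q = Q x0 / N\<^sup>2"

lemma q_pos: "q > 0"
  using Q_x0_pos N_pos by (simp add: q_def)

lemma Q_x0_eq: "Q x0 = N\<^sup>2 * q"
  using N_pos by (simp add: q_def)

lemma Z_x0_eq: "Z x0 = N\<^sup>2 * q * s0\<^sup>2"
  using Q_x0_eq pos_1_minus_sq[OF x0] by (simp add: Q_def s0_sq field_simps)

lemma q_s0: "q * s0\<^sup>2 = rad\<^sup>2 - (x0 - ctr)\<^sup>2"
  using Z_x0_eq Z_eq[of x0] N_pos by simp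

text \<open>\<open>N\<^sup>2 * (1 - q) * s0\<^sup>2\<close> is a convex combination of
  \<open>a\<^sup>2 - 1/4\<close> and \<open>b\<^sup>2 - 1/4\<close>; combine this with
  \<open>k \<le> N * rad\<close>. It serves the range where k exceeds both parameters.\<close>

lemma rad_s0_bound2: "(1 - q) * (real k)\<^sup>2 * s0\<^sup>2 \<le> rad\<^sup>2 * (max a b)\<^sup>2"
proof -
  let ?m = "max a b"
  have eq: "N\<^sup>2 * ((1 - q) * s0\<^sup>2) = (a\<^sup>2 - 1/4) * (1 + x0) / 2 + (b\<^sup>2 - 1/4) * (1 - x0) / 2"
    using Z_x0_eq unfolding Z_def s0_sq by (simp add: algebra_simps)
  also have "\<dots> \<le> ?m\<^sup>2 * (1 + x0) / 2 + ?m\<^sup>2 * (1 - x0) / 2"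
  proof (intro add_mono divide_right_mono mult_right_mono)
    have "a\<^sup>2 \<le> ?m\<^sup>2" "b\<^sup>2 \<le> ?m\<^sup>2"
      using a b by (auto intro!: power_mono)
    thus "a\<^sup>2 - 1/4 \<le> ?m\<^sup>2" "b\<^sup>2 - 1/4 \<le> ?m\<^sup>2"
      by simp_all
  qed (use x0 in auto)
  also have "\<dots> = ?m\<^sup>2"
    by (simp add: field_simps)
  finally have le: "N\<^sup>2 * ((1 - q) * s0\<^sup>2) \<le> ?m\<^sup>2" .
  have "0 \<le> N\<^sup>2 * ((1 - q) * s0\<^sup>2)"
  proof -
    have "0 \<le> 1 + x0" "0 \<le> 1 - x0"
      using x0 by auto
    hence "0 \<le> (a\<^sup>2 - 1/4) * (1 + x0)" "0 \<le> (b\<^sup>2 - 1/4) * (1 - x0)"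
      using A_pos B_pos by (simp_all only: mult_nonneg_nonneg less_imp_le)
    thus ?thesis
      unfolding eq by linarith
  qed
  hence "(1 - q) * s0\<^sup>2 \<ge> 0"
    using N_pos by (simp add: zero_le_mult_iff)
  moreover have "(real k)\<^sup>2 \<le> (N * rad)\<^sup>2"
    using N_rad_ge by (intro power_mono) (auto simp: K_def)
  ultimately have "(real k)\<^sup>2 * ((1 - q) * s0\<^sup>2) \<le> (N * rad)\<^sup>2 * ((1 - q) * s0\<^sup>2)"
    by (intro mult_right_mono)
  also have "\<dots> = rad\<^sup>2 * (N\<^sup>2 * ((1 - q) * s0\<^sup>2))"
    by (simp add: power_mult_distrib mult_ac)
  also have "\<dots> \<le> rad\<^sup>2 * ?m\<^sup>2"
    using le by (intro mult_left_mono) auto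
  finally show ?thesis
    by (simp add: mult_ac)
qed

text \<open>\<open>Q_x0_ge\<close> with the slope of Q rewritten by \<open>V_eq\<close>, and
  \<open>x0 * q\<close> weakened to \<open>q\<close>.\<close>

lemma q_main: "N * (q * sqrt q) * s0 \<ge> 4/3 * (x0 - ctr - q)"
proof -
  have sq: "sqrt (Q x0) = N * sqrt q"
    using N_pos by (simp add: Q_x0_eq real_sqrt_mult)
  have "N\<^sup>2 * (4/3 * (x0 - ctr - q)) \<le> N\<^sup>2 * (4/3 * (x0 - ctr - x0 * q))"
    using q_pos x0 by (intro mult_left_mono) (auto intro: mult_left_le_one_le)
  also have "\<dots> = 2/3 * (s0\<^sup>2 * V x0)"
    unfolding s0_sq V_eq[OF x0] Q_x0_eq by (simp add: algebra_simps)
  also have "\<dots> = s0 * (2/3 * (s0 * V x0))"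
    by (simp only: power2_eq_square mult_ac)
  also have "\<dots> \<le> s0 * (Q x0 * sqrt (Q x0))"
    using Q_x0_ge s0_pos by (intro mult_left_mono) auto
  also have "\<dots> = N\<^sup>2 * (N * (q * sqrt q) * s0)"
    unfolding sq unfolding Q_x0_eq by (simp only: mult_ac)
  finally show ?thesis
    using N_pos by simp
qed

section \<open>Explicit constants for degree at least 6\<close>

context
  assumes k6: "k \<ge> 6" and a_ge: "a \<ge> 6035/10000" and b_ge: "b \<ge> 6035/10000"
begin

lemma q_cubed: "real k < q ^ 3 * (100 * (max a b)\<^sup>2 * (real k + max a b))"
proof (rule turning_point_arith[where s = s0 and y = "x0 - ctr" and r = rad and N = N])
  show "6035/10000 \<le> max a b"
    using a_ge by simp
qed (use k6 N_pos N_le q_pos s0_pos rad_pos x0_ge q_s0 q_main rad_s0_bound1 rad_s0_bound2 k_le_rad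
     in auto)

text \<open>A crude consequence of \<open>q_cubed\<close> that serves to absorb the error
  \<open>sqrt 2 / 8\<close> of \<open>virial_bound\<close>.\<close>

lemma Q_x0_ge_1: "1 \<le> N\<^sup>2 * q"
proof -
  let ?m = "max a b"
  have pos: "?m > 0" "real k > 0" "N > 0"
    using a_ge k6 N_pos by auto
  have N: "?m / 2 \<le> N" "(real k + ?m) / 2 \<le> N" "6 \<le> N"
  proof -
    have "real k \<ge> 6"
      using k6 by simp
    thus "?m / 2 \<le> N" "(real k + ?m) / 2 \<le> N" "6 \<le> N"
      using N_eq a b unfolding K_def max_def by auto
  qed
  \<comment> \<open>162 = 6^4 / 8 splits the product into three halves and four factors 6. All but
    one of these seven are bounded by N, the last 6 by k.\<close>
  have "100 * ?m\<^sup>2 * (real k + ?m) \<le> 162 * ?m\<^sup>2 * (real k + ?m)"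
    using pos by (intro mult_right_mono) auto
  also have "\<dots> = (?m / 2) * (?m / 2) * ((real k + ?m) / 2) * (6 * 6 * 6 * 6)"
    by (simp add: power2_eq_square)
  also have "(?m / 2) * (?m / 2) * ((real k + ?m) / 2) * (6 * 6 * 6 * 6) \<le> N * N * N * (N * N * N * real k)"
    using N pos k6 by (intro mult_mono) auto
  also have "\<dots> = N ^ 6 * real k"
    by (simp add: eval_nat_numeral)
  finally have "100 * ?m\<^sup>2 * (real k + ?m) \<le> N ^ 6 * real k" .
  hence "q ^ 3 * (100 * ?m\<^sup>2 * (real k + ?m)) \<le> q ^ 3 * (N ^ 6 * real k)"
    using q_pos by (intro mult_left_mono) auto
  hence "real k * 1 < real k * (N\<^sup>2 * q) ^ 3"
    using q_cubed by (simp add: power_mult_distrib mult_ac flip: power_mult)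
  hence "1 < (N\<^sup>2 * q) ^ 3"
    using pos by simp
  hence "1 ^ 3 < (N\<^sup>2 * q) ^ 3"
    by simp
  hence "1 < N\<^sup>2 * q"
    by (rule power_less_imp_less_base) (use q_pos in simp)
  thus ?thesis by simp
qed

text \<open>Since \<open>rad - y \<le> rad\<close>, the constant \<kappa> costs at most a quarter of
  \<psi>, which leaves 3/4. The error terms change 3/4 to 0.7227 on the left and 1 to 1.003 on the
  right, and 1.003 / 0.7227 < 1.388.\<close>

lemma F_x0_le: "F x0 * sqrt q \<le> 1388/1000 * h2"
proof -
  let ?M = "F x0"
  define y where "y = x0 - ctr"
  define U where "U = N\<^sup>2 * sqrt rad"
  have y: "0 \<le> y" "y < rad"
    using x0_ge y_le_rad by (auto simp: y_def)
  have U: "U > 0"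
    using N_pos rad_pos by (simp add: U_def)
  have N_rad: "13/2 \<le> N * rad"
    using N_rad_ge k6 by (simp add: K_def)
  have \<eta>: "\<delta> - x0 = rad - y"
    by (simp add: \<delta>_def y_def)
  have "1 / (4 * sqrt rad) \<le> 1/4 * (1 / sqrt (rad - y))"
    using y rad_pos by (simp add: field_simps)
  hence "Z x0 / s0 * (3/4 * (1 / sqrt (rad - y))) \<le> Z x0 / s0 * (1 / sqrt (rad - y) - 1 / (4 * sqrt rad))"
    using Z_x0_pos s0_pos by (intro mult_left_mono) auto
  moreover have "Z x0 / s0 * (1 / sqrt (rad - y)) = N\<^sup>2 * sqrt q * sqrt (rad + y)"
  proof -
    have "sqrt q * s0 = sqrt ((rad - y) * (rad + y))"
      using q_s0 s0_pos q_pos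
      by (intro real_sqrt_unique [symmetric])
         (auto simp: power_mult_distrib y_def power2_eq_square algebra_simps)
    hence "sqrt q * s0 = sqrt (rad - y) * sqrt (rad + y)"
      by (simp add: real_sqrt_mult)
    moreover have "Z x0 = N\<^sup>2 * (sqrt q * sqrt q) * s0\<^sup>2"
      using q_pos by (simp add: Z_x0_eq)
    hence "Z x0 = N\<^sup>2 * sqrt q * s0 * (sqrt q * s0)"
      by (simp only: power2_eq_square mult_ac)
    ultimately show ?thesis
      using s0_pos y by simp
  qed
  moreover have "N\<^sup>2 * sqrt q * sqrt rad \<le> N\<^sup>2 * sqrt q * sqrt (rad + y)"
    using y q_pos by (intro mult_left_mono) auto
  ultimately have lower: "3/4 * (U * sqrt q) \<le> Z x0 / s0 * (1 / sqrt (rad - y) - 1 / (4 * sqrt rad))"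
    by (simp add: U_def mult_ac)
  \<comment> \<open>\<open>U * sqrt q\<close> is at least 13/2, and 0.0273 * 13/2 exceeds 1.415 /
    8.\<close>
  have "sqrt 2 / 8 \<le> 273/10000 * (U * sqrt q)"
  proof -
    have "(13/2)\<^sup>2 \<le> (N * rad)\<^sup>2"
      using N_rad by (intro power_mono) auto
    also have "\<dots> = N\<^sup>2 * rad * rad"
      by (simp add: power2_eq_square)
    also have "\<dots> \<le> N\<^sup>2 * rad * (N\<^sup>2 * q)"
      using rad_less_1 Q_x0_ge_1 rad_pos by (intro mult_left_mono) auto
    also have "\<dots> = (U * sqrt q)\<^sup>2"
      using rad_pos q_pos by (simp add: U_def power_mult_distrib)
    finally have "13/2 \<le> U * sqrt q"
      by (rule power2_le_imp_le) (use U q_pos in auto)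
    moreover have "sqrt 2 \<le> 1415/1000"
      by (rule real_le_lsqrt) (auto simp: power2_eq_square)
    ultimately show ?thesis by simp
  qed
  moreover have "7227/10000 * u \<le> t - c" if "3/4 * u \<le> t" "c \<le> 273/10000 * u" for u t c :: real
    using that by simp
  ultimately have "7227/10000 * (U * sqrt q) \<le>
      Z x0 / s0 * (1 / sqrt (rad - y) - 1 / (4 * sqrt rad)) - sqrt 2 / 8"
    using lower by blast
  hence "?M * (7227/10000 * (U * sqrt q)) \<le>
      ?M * (Z x0 / s0 * (1 / sqrt (rad - y) - 1 / (4 * sqrt rad)) - sqrt 2 / 8)"
    using F_pos by (intro mult_left_mono) auto
  also have "\<dots> \<le> (U + 1 / (8 * sqrt rad)) * h2"
    using virial_bound unfolding \<eta> U_def .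
  also have "\<dots> \<le> (1003/1000 * U) * h2"
  proof (intro mult_right_mono)
    have "(13/2) * (13/2) \<le> (N * rad) * (N * rad)"
      using N_rad by (intro mult_mono) auto
    also have "\<dots> = N\<^sup>2 * rad * rad"
      by (simp add: power2_eq_square)
    also have "\<dots> \<le> N\<^sup>2 * rad * 1"
      using rad_less_1 rad_pos by (intro mult_left_mono) auto
    also have "\<dots> = U * sqrt rad"
      using rad_pos by (simp add: U_def)
    finally show "U + 1 / (8 * sqrt rad) \<le> 1003/1000 * U"
      using rad_pos by (simp add: field_simps)
  qed (use h2_pos in auto)
  finally have "U * (7227/10000 * (?M * sqrt q)) \<le> U * (1003/1000 * h2)"
    by (simp add: mult_ac)
  hence "7227/10000 * (?M * sqrt q) \<le> 1003/1000 * h2"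
    using U by simp
  thus ?thesis
    using h2_pos by simp
qed

lemma F_x0_less:
  "F x0 / h2 < 3 * max a b powr (1/3) * (1 + max a b / real k) powr (1/6)"
proof -
  let ?m = "max a b"
  define X where "X = 3 * ?m powr (1/3) * (1 + ?m / real k) powr (1/6)"
  have pos: "?m > 0" "real k > 0"
    using a_ge k6 by auto
  have "X ^ 6 = 729 * (?m powr (1/3)) ^ 6 * ((1 + ?m / real k) powr (1/6)) ^ 6"
    by (simp add: X_def power_mult_distrib)
  also have "(?m powr (1/3)) ^ 6 = ?m\<^sup>2"
    using pos by (simp add: powr_power)
  also have "((1 + ?m / real k) powr (1/6)) ^ 6 = (real k + ?m) / real k"
  proof -
    have "1 + ?m / real k = (real k + ?m) / real k"
      using pos by (simp add: field_simps)
    thus ?thesis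
      using pos by (simp add: powr_power)
  qed
  finally have X: "X ^ 6 = 729 * ?m\<^sup>2 * ((real k + ?m) / real k)" .
  have "(F x0 / h2 * sqrt q) ^ 6 \<le> (1388/1000) ^ 6"
    using F_x0_le h2_pos q_pos F_pos by (intro power_mono) (auto simp: field_simps)
  also have "\<dots> < 729/100"
    by (simp add: eval_nat_numeral)
  also have "\<dots> < 729/100 * (q ^ 3 * (100 * ?m\<^sup>2 * (real k + ?m)) / real k)"
    using q_cubed pos by (simp add: field_simps)
  also have "\<dots> = X ^ 6 * q ^ 3"
    unfolding X by simp
  also have "q ^ 3 = sqrt q ^ 6"
    using q_pos power_mult[of "sqrt q" 2 3] by simp
  also have "X ^ 6 * sqrt q ^ 6 = (X * sqrt q) ^ 6"
    by (simp add: power_mult_distrib)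
  finally have "F x0 / h2 * sqrt q < X * sqrt q"
    by (rule power_less_imp_less_base) (use q_pos in \<open>simp add: X_def\<close>)
  hence "F x0 / h2 < X"
    by (rule mult_right_less_imp_less) (use q_pos in simp)
  thus ?thesis
    by (simp only: X_def)
qed

end

end

section \<open>Reflection and conclusion\<close>

lemma jacobi_F_reflect:
  assumes "jacobi k a b"
  shows "jacobi.F k a b (-x) = jacobi.F k b a x"
proof -
  interpret A: jacobi k a b by fact
  interpret B: jacobi k b a
    using A.k A.a A.b by unfold_locales
  show ?thesis
    by (simp add: A.F_def B.F_def A.P_def B.P_def jacobi_weight_def jacobiP_reflect
        power_mult_distrib power_mult [symmetric] mult.commute)
qed

lemma jacobi_h2_commute: "jacobi_h2 k a b = jacobi_h2 k b a"
  by (simp add: jacobi_h2_def add_ac mult_ac)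

theorem theorem2:
  fixes k :: nat and \<alpha> \<beta> :: real
  assumes "k \<ge> 6" and "\<alpha> \<ge> \<beta>" and "\<beta> \<ge> (1 + sqrt 2) / 4"
  shows "jacobiM k \<alpha> \<beta> < 3 * \<alpha> powr (1/3) * (1 + \<alpha> / real k) powr (1/6)"
proof -
  have "sqrt 2 \<ge> 1414/1000"
    by (rule real_le_rsqrt) (simp add: power2_eq_square)
  hence \<beta>: "\<beta> \<ge> 6035/10000"
    using assms(3) by simp
  interpret A: jacobi k \<alpha> \<beta>
    using assms \<beta> by unfold_locales auto
  interpret B: jacobi k \<beta> \<alpha>
    using assms \<beta> by unfold_locales auto
  define h where "h = jacobi_h2 k \<alpha> \<beta>"
  have h: "h > 0"
    unfolding h_def using assms \<beta> by (intro jacobi_h2_pos) auto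
  let ?rhs = "3 * \<alpha> powr (1/3) * (1 + \<alpha> / real k) powr (1/6)"
  obtain x0 where x0: "x0 \<in> {-1..1}" "\<And>x. x \<in> {-1..1} \<Longrightarrow> A.F x \<le> A.F x0"
    using continuous_attains_sup[OF _ _ A.continuous_on_F] by fastforce
  have F: "(1 - x) powr (\<alpha> + 1/2) * (1 + x) powr (\<beta> + 1/2) * (jacobiPn k \<alpha> \<beta> x)\<^sup>2 = A.F x / h" for x
    using h by (simp add: A.F_def A.P_def jacobiPn_def jacobi_weight_def power_divide flip: h_def)
  have "jacobiM k \<alpha> \<beta> \<le> A.F x0 / h"
    unfolding jacobiM_def F using x0(2) h by (intro cSUP_least divide_right_mono) auto
  also have "\<dots> < ?rhs"
  \<comment> \<open>\<open>jacobi_max\<close> presupposes a positive maximum; for the value zero the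
    positive right-hand side is enough.\<close>
  proof (cases "A.F x0 = 0")
    case True
    moreover have "0 < 1 + \<alpha> / real k"
      using assms \<beta> by (intro add_pos_nonneg) auto
    ultimately show ?thesis
      using assms \<beta> by simp
  next
    case False
    hence pos: "A.F x0 > 0"
      using A.F_nonneg[of x0] by simp
    have "x0 \<noteq> 1" "x0 \<noteq> -1"
      using False by auto
    hence x1: "\<bar>x0\<bar> < 1"
      using x0(1) by auto
    have refl: "A.F (-x) = B.F x" for x
      by (rule jacobi_F_reflect) unfold_locales
    show ?thesis
    \<comment> \<open>A maximum left of the midpoint is reflected: \<open>-x0\<close> is a maximum
      for the exchanged parameters and lies right of their midpoint.\<close>
    proof (cases "A.ctr \<le> x0")
      case True
      interpret jacobi_max k \<alpha> \<beta> x0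
        using x0(2) pos x1 True by unfold_locales
      show ?thesis
        using F_x0_less assms \<beta> by (simp add: h2_def h_def max_def split: if_splits)
    next
      case False
      have BF: "B.F (-x0) = A.F x0"
        using refl[of "-x0"] by simp
      interpret jacobi_max k \<beta> \<alpha> "-x0"
      proof unfold_locales
        show "B.F x \<le> B.F (-x0)" if "x \<in> {-1..1}" for x
          using x0(2)[of "-x"] that refl[of x] BF by simp
        have "B.ctr = - A.ctr"
          by (simp add: A.ctr_def B.ctr_def A.N_def B.N_def add_ac minus_divide_left)
        thus "B.ctr \<le> -x0"
          using False by simp
      qed (use x1 pos BF in auto)
      show ?thesis
        using F_x0_less assms \<beta>
        by (simp add: BF h2_def h_def jacobi_h2_commute[of k \<alpha>] max_def split: if_splits)
    qed
  qed
  finally show ?thesis .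
qed

end
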